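(* Let $S(t)$, $t\ge 0$, be a strongly continuous semigroup with generator $A$ on a complex Hilbert space $\mathcal H$. Let $\omega\in\mathbb R$ and assume that the half-plane $\{\Re z\ge\omega\}$ is contained in the resolvent set of $A$ and that $\|(z-A)^{-1}\|$ is uniformly bounded there; let $r(\omega)\in\,]0,+\infty[$ be defined by $\frac1{r(\omega)}=\sup_{\Re z>\omega}\|(z-A)^{-1}\|$. Let $m:[0,+\infty[\to\,]0,+\infty[$ be continuous with $\|S(t)\|\le m(t)$ for all $t\ge0$. Let $\Phi,\Psi\in C^1([0,+\infty[)$ be real-valued functions with $\Phi(0)=\Psi(0)=0$ and $\Phi(s)>0$, $\Psi(s)>0$ for $s>0$, and let $\epsilon_1,\epsilon_2\in\{-,+\}$. Then for every $t>0$, $$\|S(t)\|_{\mathcal L(\mathcal H)}\le e^{\omega t}\,\frac{\big\|(r(\omega)^2\Phi^2-\Phi'^2)_-^{1/2}\,m\big\|_{e^{\omega\cdot}L^2([0,t[)}\ \big\|(r(\omega)^2\Psi^2-\Psi'^2)_-^{1/2}\,m\big\|_{e^{\omega\cdot}L^2([0,t[)}}{\displaystyle\int_0^t\big(r(\omega)^2\Phi(s)^2-\Phi'(s)^2\big)_{\epsilon_1}^{1/2}\,\big(r(\omega)^2\Psi(t-s)^2-\Psi'(t-s)^2\big)_{\epsilon_2}^{1/2}\,ds}.$$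
   Context: For $x\in\mathbb R$: $x_+=\max(x,0)$, $x_-=\max(-x,0)$, and $(x)_{\pm}^{1/2}=(x_\pm)^{1/2}$. The weighted norm is $\|f\|_{e^{\omega\cdot}L^2([0,t[)}=\|e^{-\omega\cdot}f\|_{L^2([0,t[)}=\left(\int_0^t e^{-2\omega s}|f(s)|^2ds\right)^{1/2}$. If the denominator vanishes, the right-hand side is read as $+\infty$. *)

theory Defs
  imports "HOL-Analysis.Analysis"
begin

class complex_vector = real_vector +
  fixes scaleC :: "complex \<Rightarrow> 'a \<Rightarrow> 'a"  (infixr "*\<^sub>C" 75)
  assumes scaleC_add_right: "a *\<^sub>C (x + y) = a *\<^sub>C x + a *\<^sub>C y"
    and scaleC_add_left: "(a + b) *\<^sub>C x = a *\<^sub>C x + b *\<^sub>C x"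
    and scaleC_scaleC: "a *\<^sub>C (b *\<^sub>C x) = (a * b) *\<^sub>C x"
    and scaleC_one: "1 *\<^sub>C x = x"
    and scaleR_scaleC: "r *\<^sub>R x = complex_of_real r *\<^sub>C x"

text \<open>The real inner product inherited from \<open>real_inner\<close> is the real part of \<open>cinner\<close>,
  so that norm and topology are those of the complex inner product.\<close>

class complex_inner = complex_vector + real_inner +
  fixes cinner :: "'a \<Rightarrow> 'a \<Rightarrow> complex"
  assumes cinner_commute: "cinner x y = cnj (cinner y x)"
    and cinner_add_left: "cinner (x + y) z = cinner x z + cinner y z"
    and cinner_scaleC_left: "cinner (c *\<^sub>C x) y = c * cinner x y"
    and inner_eq_Re_cinner: "inner x y = Re (cinner x y)"

class complex_hilbert_space = complex_inner + complete_space

definition bounded_clinear :: "('a::complex_hilbert_space \<Rightarrow> 'a) \<Rightarrow> bool" where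
  "bounded_clinear f \<longleftrightarrow> bounded_linear f \<and> (\<forall>c x. f (c *\<^sub>C x) = c *\<^sub>C f x)"

definition strongly_continuous_semigroup ::
    "(real \<Rightarrow> 'a::complex_hilbert_space \<Rightarrow> 'a) \<Rightarrow> bool" where
  "strongly_continuous_semigroup S \<longleftrightarrow>
     (\<forall>t\<ge>0. bounded_clinear (S t)) \<and>
     S 0 = id \<and>
     (\<forall>s\<ge>0. \<forall>t\<ge>0. S (s + t) = S s \<circ> S t) \<and>
     (\<forall>x. continuous_on {0..} (\<lambda>t. S t x))"

text \<open>An unbounded operator is given by its domain \<open>D\<close> and a function \<open>A\<close>
  whose values outside \<open>D\<close> are irrelevant.\<close>

definition generator_domain :: "(real \<Rightarrow> 'a::complex_hilbert_space \<Rightarrow> 'a) \<Rightarrow> 'a set" where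
  "generator_domain S = {x. \<exists>y. ((\<lambda>h. (S h x - x) /\<^sub>R h) \<longlongrightarrow> y) (at_right 0)}"

definition generator :: "(real \<Rightarrow> 'a::complex_hilbert_space \<Rightarrow> 'a) \<Rightarrow> 'a \<Rightarrow> 'a" where
  "generator S x = Lim (at_right 0) (\<lambda>h. (S h x - x) /\<^sub>R h)"

definition resolvent ::
    "'a::complex_hilbert_space set \<Rightarrow> ('a \<Rightarrow> 'a) \<Rightarrow> complex \<Rightarrow> 'a \<Rightarrow> 'a" where
  "resolvent D A z = inv_into D (\<lambda>x. z *\<^sub>C x - A x)"

definition resolvent_set ::
    "'a::complex_hilbert_space set \<Rightarrow> ('a \<Rightarrow> 'a) \<Rightarrow> complex set" where
  "resolvent_set D A =
     {z. bij_betw (\<lambda>x. z *\<^sub>C x - A x) D UNIV \<and> bounded_clinear (resolvent D A z)}"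

datatype sign = Minus | Plus

fun signed_part :: "sign \<Rightarrow> real \<Rightarrow> real" where
  "signed_part Plus x = max x 0"
| "signed_part Minus x = max (- x) 0"

definition weighted_L2_norm :: "real \<Rightarrow> real \<Rightarrow> (real \<Rightarrow> real) \<Rightarrow> real" where
  "weighted_L2_norm \<omega> t f = sqrt (LINT s:{0..<t}|lborel. exp (- 2 * \<omega> * s) * \<bar>f s\<bar>\<^sup>2)"

text \<open>Unlike division on \<^typ>\<open>ereal\<close>, where \<open>0 / 0 = 0\<close>, every quotient with
  vanishing denominator is \<open>\<infinity>\<close>.\<close>

definition quotient_or_infinity :: "real \<Rightarrow> real \<Rightarrow> ereal" where
  "quotient_or_infinity a b = (if b = 0 then \<infinity> else ereal (a / b))"

end

theory Submission
  imports Defs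
begin

text \<open>
  Write \<open>S\<^sub>\<beta> s = e\<^bsup>-\<beta>s\<^esup> S s\<close>. The engine of the proof is the weighted estimate
  \<open>\<integral>\<^sub>0\<^sup>t (r\<^sup>2 \<Phi>\<^sup>2 - \<Phi>'\<^sup>2) \<parallel>S\<^sub>\<omega> s x\<parallel>\<^sup>2 ds \<le> 0\<close> for weights with \<open>\<Phi> 0 = 0\<close>
  (\<open>weight_estimate\<close>): the function \<open>u = \<Phi> S\<^sub>\<omega> x\<close> solves \<open>u' = (A - \<omega>) u + v\<close> with
  \<open>v = \<Phi>' S\<^sub>\<omega> x\<close> and \<open>u 0 = 0\<close>, so in frequency space \<open>u\<close> is the resolvent applied to \<open>v\<close>, and the
  resolvent has norm at most \<open>1/r\<close>. Moving the negative part of \<open>r\<^sup>2 \<Phi>\<^sup>2 - \<Phi>'\<^sup>2\<close> to the other side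
  and bounding \<open>\<parallel>S s\<parallel>\<close> by \<open>m s\<close> there gives \<open>\<integral>\<^sub>0\<^sup>t (r\<^sup>2 \<Phi>\<^sup>2 - \<Phi>'\<^sup>2)\<^sub>\<epsilon> \<parallel>S\<^sub>\<omega> s x\<parallel>\<^sup>2 ds \<le> N\<^sup>2 \<parallel>x\<parallel>\<^sup>2\<close>
  with the weighted norm \<open>N\<close> from the numerator, for either sign \<open>\<epsilon>\<close> (\<open>signed_weight_estimate\<close>).
  The same holds for the adjoint semigroup and \<open>\<Psi>\<close>. Since
  \<open>\<parallel>S t x\<parallel>\<^sup>2 = \<langle>S s x, (S (t - s))\<^sup>* S t x\<rangle>\<close> for every \<open>s\<close> in \<open>[0, t]\<close>, multiplying by the two
  square roots of weights, integrating over \<open>s\<close> and using the Cauchy-Schwarz inequality yields the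
  theorem.

  The frequency argument is carried out with Fourier series rather than the Fourier transform. The
  weight is extended from \<open>[0, t]\<close> to \<open>[0, T]\<close> by letting it decrease linearly to zero, so that
  \<open>u\<close> is continuous with \<open>u 0 = u T\<close>; at \<open>z\<^sub>k = \<beta> + 2\<pi>ik/T\<close> an integration by parts shows
  that the \<open>k\<close>-th Fourier coefficient of \<open>u\<close> is the resolvent at \<open>z\<^sub>k\<close> applied to that of \<open>v\<close>.
  Bessel's inequality for \<open>v\<close> and Parseval's inequality for \<open>u\<close>
  (\<open>L2_norm_le_by_fourier_coeffs\<close>) then compare the two square integrals. The additional slope on
  \<open>[t, T]\<close> contributes \<open>O(1/(T - t))\<close> as long as \<open>S\<^sub>\<beta>\<close> is bounded, and disappears as
  \<open>T \<rightarrow> \<infinity>\<close> (\<open>weight_estimate_if_exp_bounded\<close>).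

  Boundedness of \<open>S\<^sub>\<beta>\<close> is known at first only for large \<open>\<beta>\<close>. It propagates to every \<open>\<beta> > \<omega>\<close>,
  because the estimate at \<open>\<beta>\<close> for the weight \<open>s e\<^bsup>rs/2\<^esup>\<close> bounds the integral of
  \<open>\<parallel>S\<^bsub>\<beta> - r/2\<^esub> s x\<parallel>\<^sup>2\<close>, and by the semigroup law a uniform square-integral bound is a
  uniform pointwise bound (\<open>exp_bounded_step\<close>). Thus finitely many steps of length \<open>r/2\<close> reach each
  \<open>\<beta> > \<omega>\<close>, and \<open>\<omega>\<close> itself is reached by letting \<open>\<beta>\<close> decrease to \<open>\<omega>\<close> on the fixed interval \<open>[0, t]\<close>.
\<close>

section \<open>Complex Hilbert spaces\<close>

instance complex_hilbert_space \<subseteq> banach ..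

lemma scaleC_zero_left [simp]: "0 *\<^sub>C (x::'a::complex_vector) = 0"
  by (metis scaleR_scaleC of_real_0 scaleR_zero_left)

lemma scaleC_zero_right [simp]: "c *\<^sub>C (0::'a::complex_vector) = 0"
  using scaleC_add_right[of c "0::'a" 0] by simp

lemma inner_scaleC_left: "inner (c *\<^sub>C x) y = inner x (cnj c *\<^sub>C (y::'a::complex_inner))"
proof -
  have "cinner x (cnj c *\<^sub>C y) = c * cinner x y"
    by (metis cinner_commute cinner_scaleC_left complex_cnj_cnj complex_cnj_mult)
  then show ?thesis
    by (simp add: inner_eq_Re_cinner cinner_scaleC_left)
qed

lemma norm_scaleC: "norm (c *\<^sub>C x) = cmod c * norm (x::'a::complex_inner)"
proof -
  have "(norm (c *\<^sub>C x))\<^sup>2 = inner x ((cnj c * c) *\<^sub>C x)"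
    by (simp add: power2_norm_eq_inner inner_scaleC_left scaleC_scaleC)
  also have "\<dots> = inner x ((cmod c)\<^sup>2 *\<^sub>R x)"
    by (simp add: scaleR_scaleC mult.commute flip: complex_norm_square)
  also have "\<dots> = (cmod c * norm x)\<^sup>2"
    by (simp add: power2_norm_eq_inner power_mult_distrib)
  finally show ?thesis
    by (simp add: power2_eq_iff_nonneg)
qed

lemma bounded_bilinear_scaleC: "bounded_bilinear (\<lambda>c (x::'a::complex_inner). c *\<^sub>C x)"
proof
  show "\<exists>K. \<forall>a (b::'a). norm (a *\<^sub>C b) \<le> norm a * norm b * K"
    by (rule exI[of _ 1]) (simp add: norm_scaleC)
  fix r a and b :: 'a
  show "(r *\<^sub>R a) *\<^sub>C b = r *\<^sub>R (a *\<^sub>C b)"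
    by (simp add: scaleR_scaleC scaleC_scaleC scaleR_conv_of_real)
  show "a *\<^sub>C (r *\<^sub>R b) = r *\<^sub>R (a *\<^sub>C b)"
    by (simp add: scaleR_scaleC scaleC_scaleC mult.commute)
qed (auto simp: scaleC_add_right scaleC_add_left)

lemmas bounded_linear_scaleC_left = bounded_bilinear.bounded_linear_left[OF bounded_bilinear_scaleC]
lemmas bounded_linear_scaleC_right = bounded_bilinear.bounded_linear_right[OF bounded_bilinear_scaleC]
lemmas continuous_on_scaleC [continuous_intros] = bounded_bilinear.continuous_on[OF bounded_bilinear_scaleC]

section \<open>Fourier coefficients on a bounded interval\<close>

definition wave :: "real \<Rightarrow> int \<Rightarrow> real \<Rightarrow> complex" where
  "wave T k s = cis (2 * pi * of_int k * s / T)"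

definition fourier_coeff :: "real \<Rightarrow> (real \<Rightarrow> 'a::complex_hilbert_space) \<Rightarrow> int \<Rightarrow> 'a" where
  "fourier_coeff T f k = integral {0..T} (\<lambda>s. wave T (- k) s *\<^sub>C f s) /\<^sub>R T"

lemma cnj_wave: "cnj (wave T k s) = wave T (- k) s"
  by (simp add: wave_def cis_cnj)

lemma wave_mult: "wave T k s * wave T l s = wave T (k + l) s"
  by (simp add: wave_def cis_mult algebra_simps add_divide_distrib)

lemma wave_diff: "wave T k (s - \<sigma>) = wave T k s * wave T (- k) \<sigma>"
  by (simp add: wave_def cis_mult algebra_simps diff_divide_distrib)

lemma continuous_on_wave [continuous_intros]: "continuous_on A (wave T k)"
  unfolding wave_def[abs_def] cis_conv_exp divide_inverse by (intro continuous_intros)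

lemma has_integral_wave:
  assumes "T > 0"
  shows "(wave T k has_integral (if k = 0 then complex_of_real T else 0)) {0..T}"
proof (cases "k = 0")
  case True
  have "((\<lambda>s. 1::complex) has_integral complex_of_real T) {0..T}"
    using has_integral_const_real[of "1::complex" 0 T] assms by (simp add: scaleR_conv_of_real)
  then show ?thesis
    using True by (simp add: wave_def[abs_def])
next
  case False
  define c where "c = \<i> * (2 * pi * of_int k / T)"
  have c: "c \<noteq> 0"
    using False assms by (simp add: c_def)
  have wave: "wave T k s = exp (c * of_real s)" for s
    by (simp add: wave_def cis_conv_exp c_def mult.assoc)
  have "((\<lambda>s. exp (c * of_real s) / c) has_vector_derivative wave T k s) (at s within {0..T})" for s
  proof -
    have "((\<lambda>z. exp (c * z) / c) has_field_derivative exp (c * of_real s)) (at (of_real s))"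
      using c by (auto intro!: derivative_eq_intros)
    then show ?thesis
      unfolding wave by (rule has_vector_derivative_real_field)
  qed
  then have "(wave T k has_integral exp (c * of_real T) / c - exp (c * of_real 0) / c) {0..T}"
    using assms by (intro fundamental_theorem_of_calculus) auto
  moreover have "exp (c * of_real T) = 1"
    using cis_multiple_2pi[of "of_int k"] assms by (simp flip: wave add: wave_def mult_ac)
  ultimately show ?thesis
    using False by simp
qed

text \<open>One expansion of the square serves two purposes: \<open>c k = 1\<close> gives Bessel's inequality, and since
  \<open>2 c - c\<^sup>2 \<le> 1\<close> for every real \<open>c\<close>, any approximation of \<open>f\<close> by damped partial sums of its
  Fourier series bounds its square integral by the squares of its coefficients, up to the square
  integral of the error. The hypotheses are stated as integrability so that the inequality covers functions with a jump.\<close>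
lemma norm_diff_fourier_sum_has_integral:
  fixes f :: "real \<Rightarrow> 'a::complex_hilbert_space" and c :: "int \<Rightarrow> real"
  assumes T: "T > 0" and K: "finite K"
    and square: "(\<lambda>s. (norm (f s))\<^sup>2) integrable_on {0..T}"
    and coeff: "\<And>k. (\<lambda>s. wave T k s *\<^sub>C f s) integrable_on {0..T}"
  shows "((\<lambda>s. (norm (f s - (\<Sum>k\<in>K. c k *\<^sub>R wave T k s *\<^sub>C fourier_coeff T f k)))\<^sup>2)
           has_integral integral {0..T} (\<lambda>s. (norm (f s))\<^sup>2)
             - T * (\<Sum>k\<in>K. (2 * c k - (c k)\<^sup>2) * (norm (fourier_coeff T f k))\<^sup>2)) {0..T}"
proof -
  define a where "a = fourier_coeff T f"
  define A where "A k s = wave T k s *\<^sub>C a k" for k s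
  \<comment> \<open>The waves are orthogonal, so only diagonal terms survive in both kinds of inner products.\<close>
  have cross: "((\<lambda>s. inner (f s) (A k s)) has_integral T * (norm (a k))\<^sup>2) {0..T}" for k
  proof -
    have "((\<lambda>s. inner (wave T (- k) s *\<^sub>C f s) (a k)) has_integral
        inner (integral {0..T} (\<lambda>s. wave T (- k) s *\<^sub>C f s)) (a k)) {0..T}"
      using has_integral_linear[OF integrable_integral[OF coeff[of "- k"]] bounded_linear_inner_left]
      by (simp add: o_def)
    moreover have "integral {0..T} (\<lambda>s. wave T (- k) s *\<^sub>C f s) = T *\<^sub>R a k"
      using T by (simp add: a_def fourier_coeff_def)
    ultimately show ?thesis
      by (simp add: A_def inner_scaleC_left cnj_wave power2_norm_eq_inner)
  qed
  have double: "((\<lambda>s. inner (A k s) (A l s)) has_integral (if k = l then T * (norm (a k))\<^sup>2 else 0)) {0..T}"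
    for k l
  proof -
    have "((\<lambda>s. inner (a k) (wave T (l - k) s *\<^sub>C a l)) has_integral
        inner (a k) ((if l - k = 0 then complex_of_real T else 0) *\<^sub>C a l)) {0..T}"
      using has_integral_linear[OF has_integral_linear[OF has_integral_wave[OF T]
            bounded_linear_scaleC_left] bounded_linear_inner_right]
      unfolding o_def .
    moreover have "inner (A k s) (A l s) = inner (a k) (wave T (l - k) s *\<^sub>C a l)" for s
      by (simp add: A_def inner_scaleC_left cnj_wave scaleC_scaleC wave_mult)
    ultimately show ?thesis
      by (auto simp: power2_norm_eq_inner split: if_splits simp flip: scaleR_scaleC)
  qed
  have expand: "(norm (f s - (\<Sum>k\<in>K. c k *\<^sub>R A k s)))\<^sup>2 = (norm (f s))\<^sup>2
      - 2 * (\<Sum>k\<in>K. c k * inner (f s) (A k s))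
      + (\<Sum>k\<in>K. \<Sum>l\<in>K. c k * (c l * inner (A k s) (A l s)))" for s
    by (simp add: power2_norm_eq_inner inner_diff_left inner_diff_right inner_sum_left
        inner_sum_right inner_commute sum_distrib_left)
      (simp add: algebra_simps sum_distrib_left sum_negf)
  have "((\<lambda>s. (norm (f s - (\<Sum>k\<in>K. c k *\<^sub>R A k s)))\<^sup>2) has_integral
      integral {0..T} (\<lambda>s. (norm (f s))\<^sup>2)
      - 2 * (\<Sum>k\<in>K. c k * (T * (norm (a k))\<^sup>2))
      + (\<Sum>k\<in>K. \<Sum>l\<in>K. c k * (c l * (if k = l then T * (norm (a k))\<^sup>2 else 0)))) {0..T}"
    unfolding expand
    by (intro has_integral_add has_integral_diff has_integral_mult_right has_integral_sum
        integrable_integral square cross double K)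
  also have "(\<Sum>k\<in>K. \<Sum>l\<in>K. c k * (c l * (if k = l then T * (norm (a k))\<^sup>2 else 0)))
      = (\<Sum>k\<in>K. (c k)\<^sup>2 * (T * (norm (a k))\<^sup>2))"
    using K by (intro sum.cong refl) (simp add: if_distrib power2_eq_square cong: if_cong)
  finally show ?thesis
    unfolding A_def a_def by (simp add: sum_distrib_left algebra_simps sum_subtractf)
qed

lemma bessel_inequality:
  fixes f :: "real \<Rightarrow> 'a::complex_hilbert_space"
  assumes T: "T > 0" and K: "finite K"
    and square: "(\<lambda>s. (norm (f s))\<^sup>2) integrable_on {0..T}"
    and coeff: "\<And>k. (\<lambda>s. wave T k s *\<^sub>C f s) integrable_on {0..T}"
  shows "T * (\<Sum>k\<in>K. (norm (fourier_coeff T f k))\<^sup>2) \<le> integral {0..T} (\<lambda>s. (norm (f s))\<^sup>2)"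
  using has_integral_nonneg[OF norm_diff_fourier_sum_has_integral[OF assms, of "\<lambda>k. 1"]] by simp

text \<open>The de la Vallee Poussin kernel: a nonnegative trigonometric polynomial of mean one that
  concentrates at the multiples of \<open>T\<close> as \<open>n\<close> grows.\<close>
definition cos_kernel :: "nat \<Rightarrow> real \<Rightarrow> real \<Rightarrow> real" where
  "cos_kernel n T s = 4 ^ n / real ((2 * n) choose n) * cos (pi * s / T) ^ (2 * n)"

definition cos_kernel_coeff :: "nat \<Rightarrow> int \<Rightarrow> real" where
  "cos_kernel_coeff n k = real ((2 * n) choose nat (k + int n)) / real ((2 * n) choose n)"

text \<open>The binomial expansion of \<open>(2 cos x)\<^bsup>2n\<^esup> = (e\<^bsup>ix\<^esup> + e\<^bsup>-ix\<^esup>)\<^bsup>2n\<^esup>\<close> with \<open>x = \<pi> s / T\<close>.\<close>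
lemma cos_kernel_eq_sum_wave:
  "complex_of_real (cos_kernel n T s) =
    (\<Sum>k\<in>{- int n..int n}. cos_kernel_coeff n k *\<^sub>R wave T k s)"
proof -
  define x where "x = pi * s / T"
  have "(cis x + cis (- x)) ^ (2 * n) =
      (\<Sum>j\<le>2 * n. of_nat ((2 * n) choose j) * cis x ^ j * cis (- x) ^ (2 * n - j))"
    by (rule binomial_ring)
  also have "\<dots> = (\<Sum>j\<le>2 * n. of_nat ((2 * n) choose j) * wave T (int j - int n) s)"
  proof (intro sum.cong refl)
    fix j assume "j \<in> {..2 * n}"
    then have "real j * x + real (2 * n - j) * (- x) = 2 * pi * of_int (int j - int n) * s / T"
      by (simp add: x_def of_nat_diff algebra_simps diff_divide_distrib)
    then have "cis x ^ j * cis (- x) ^ (2 * n - j) = wave T (int j - int n) s"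
      by (simp only: wave_def Complex.DeMoivre cis_mult)
    then show "of_nat ((2 * n) choose j) * cis x ^ j * cis (- x) ^ (2 * n - j) =
        of_nat ((2 * n) choose j) * wave T (int j - int n) s"
      by (simp only: mult.assoc)
  qed
  also have "\<dots> = (\<Sum>k\<in>{- int n..int n}. of_nat ((2 * n) choose nat (k + int n)) * wave T k s)"
    by (rule sum.reindex_bij_witness[of _ "\<lambda>k. nat (k + int n)" "\<lambda>j. int j - int n"]) auto
  finally have "(\<Sum>k\<in>{- int n..int n}. cos_kernel_coeff n k *\<^sub>R wave T k s)
      = (cis x + cis (- x)) ^ (2 * n) / of_nat ((2 * n) choose n)"
    by (simp add: cos_kernel_coeff_def sum_divide_distrib scaleR_conv_of_real)
  also have "cis x + cis (- x) = complex_of_real (2 * cos x)"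
    by (simp add: complex_eq_iff)
  also have "\<dots> ^ (2 * n) / of_nat ((2 * n) choose n) = complex_of_real (cos_kernel n T s)"
    by (simp add: cos_kernel_def x_def power_mult_distrib power_mult)
  finally show ?thesis ..
qed

lemma cos_kernel_nonneg: "cos_kernel n T s \<ge> 0"
  by (simp add: cos_kernel_def power_mult)

text \<open>Only the constant term of the kernel contributes, and dividing by the central binomial
  coefficient makes that term equal to one.\<close>
lemma cos_kernel_has_integral:
  assumes "T > 0"
  shows "((\<lambda>\<sigma>. cos_kernel n T (s - \<sigma>)) has_integral T) {0..T}"
proof -
  have "((\<lambda>\<sigma>. \<Sum>k\<in>{- int n..int n}. cos_kernel_coeff n k *\<^sub>R (wave T k s * wave T (- k) \<sigma>))
      has_integral (\<Sum>k\<in>{- int n..int n}. cos_kernel_coeff n k *\<^sub>R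
        (wave T k s * (if - k = 0 then complex_of_real T else 0)))) {0..T}"
    by (intro has_integral_sum has_integral_cmul has_integral_mult_right has_integral_wave assms) auto
  also have "(\<Sum>k\<in>{- int n..int n}. cos_kernel_coeff n k *\<^sub>R
        (wave T k s * (if - k = 0 then complex_of_real T else 0)))
      = (\<Sum>k\<in>{- int n..int n}. if k = 0 then complex_of_real T else 0)"
    by (intro sum.cong refl) (auto simp: cos_kernel_coeff_def wave_def)
  finally have "((\<lambda>\<sigma>. complex_of_real (cos_kernel n T (s - \<sigma>))) has_integral complex_of_real T) {0..T}"
    by (simp add: cos_kernel_eq_sum_wave wave_diff)
  from has_integral_linear[OF this bounded_linear_Re] show ?thesis
    by (simp add: o_def)
qed

text \<open>The convolution with the kernel is a damped Fourier sum of \<open>f\<close>, hence an admissible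
  approximation in the expansion of the square above.\<close>
lemma cos_kernel_convolution_has_integral:
  fixes f :: "real \<Rightarrow> 'a::complex_hilbert_space"
  assumes T: "T > 0" and coeff: "\<And>k. (\<lambda>s. wave T k s *\<^sub>C f s) integrable_on {0..T}"
  shows "((\<lambda>\<sigma>. cos_kernel n T (s - \<sigma>) *\<^sub>R f \<sigma>) has_integral
    T *\<^sub>R (\<Sum>k\<in>{- int n..int n}. cos_kernel_coeff n k *\<^sub>R wave T k s *\<^sub>C fourier_coeff T f k)) {0..T}"
proof -
  have scaleC_sum: "(\<Sum>k\<in>I. g k) *\<^sub>C y = (\<Sum>k\<in>I. g k *\<^sub>C y)" for I g and y :: 'a
    using bounded_bilinear.sum_left[OF bounded_bilinear_scaleC] .
  have scaleR_scaleC': "b *\<^sub>R (d *\<^sub>C y) = (b *\<^sub>R d) *\<^sub>C y" for b d and y :: 'a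
    using bounded_bilinear.scaleR_left[OF bounded_bilinear_scaleC, of b d y] by simp
  have scaleR_right: "d *\<^sub>C (b *\<^sub>R y) = b *\<^sub>R (d *\<^sub>C y)" for b d and y :: 'a
    using bounded_bilinear.scaleR_right[OF bounded_bilinear_scaleC] .
  have hi: "((\<lambda>\<sigma>. wave T k s *\<^sub>C (wave T (- k) \<sigma> *\<^sub>C f \<sigma>)) has_integral
      wave T k s *\<^sub>C integral {0..T} (\<lambda>s. wave T (- k) s *\<^sub>C f s)) {0..T}" for k
    using has_integral_linear[OF integrable_integral[OF coeff] bounded_linear_scaleC_right]
    unfolding o_def .
  have "((\<lambda>\<sigma>. \<Sum>k\<in>{- int n..int n}. cos_kernel_coeff n k *\<^sub>R wave T k s *\<^sub>C (wave T (- k) \<sigma> *\<^sub>C f \<sigma>))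
      has_integral (\<Sum>k\<in>{- int n..int n}. cos_kernel_coeff n k *\<^sub>R wave T k s *\<^sub>C
        integral {0..T} (\<lambda>s. wave T (- k) s *\<^sub>C f s))) {0..T}"
    by (intro has_integral_sum has_integral_cmul hi) auto
  moreover have "integral {0..T} (\<lambda>s. wave T (- k) s *\<^sub>C f s) = T *\<^sub>R fourier_coeff T f k" for k
    using T by (simp add: fourier_coeff_def)
  moreover have "cos_kernel n T (s - \<sigma>) *\<^sub>R f \<sigma> =
      (\<Sum>k\<in>{- int n..int n}. cos_kernel_coeff n k *\<^sub>R wave T k s *\<^sub>C (wave T (- k) \<sigma> *\<^sub>C f \<sigma>))" for \<sigma>
    by (simp add: scaleR_scaleC[of "cos_kernel n T (s - \<sigma>)"] cos_kernel_eq_sum_wave wave_diff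
        scaleC_sum scaleR_scaleC' scaleC_scaleC)
  ultimately show ?thesis
    by (simp add: scaleR_sum_right scaleR_right mult.commute)
qed

text \<open>Away from the multiples of \<open>T\<close> the cosine is bounded by a constant below one in modulus, while
  the normalising factor \<open>4\<^sup>n / (2n choose n)\<close> grows at most linearly.\<close>
lemma cos_kernel_tail_bound:
  assumes T: "T > 0" and n: "n > 0" and \<delta>: "0 < \<delta>" "\<delta> < T / 2"
    and d: "\<delta> \<le> \<bar>s\<bar>" "\<bar>s\<bar> \<le> T - \<delta>"
  shows "cos_kernel n T s \<le> 2 * (real n * ((cos (pi * \<delta> / T))\<^sup>2) ^ n)"
proof -
  have *: "pi * \<delta> / T \<le> pi * \<bar>s\<bar> / T" "pi * \<bar>s\<bar> / T \<le> pi - pi * \<delta> / T" "0 \<le> pi * \<delta> / T"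
    "pi * \<bar>s\<bar> / T \<le> pi" "pi - pi * \<delta> / T \<le> pi"
    using d T \<delta> mult_left_mono[of "\<delta> + \<bar>s\<bar>" T pi] by (auto simp: field_simps)
  have "cos (pi * \<bar>s\<bar> / T) \<le> cos (pi * \<delta> / T)"
    using * by (intro cos_monotone_0_pi_le) auto
  moreover have "cos (pi - pi * \<delta> / T) \<le> cos (pi * \<bar>s\<bar> / T)"
    using * by (intro cos_monotone_0_pi_le) auto
  moreover have "cos (pi * \<bar>s\<bar> / T) = cos (pi * s / T)"
    by (cases "s \<ge> 0") auto
  ultimately have "\<bar>cos (pi * s / T)\<bar> \<le> \<bar>cos (pi * \<delta> / T)\<bar>"
    by (simp add: cos_diff)
  then have "(cos (pi * s / T))\<^sup>2 \<le> (cos (pi * \<delta> / T))\<^sup>2"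
    by (rule abs_le_square_iff[THEN iffD1])
  then have le: "cos (pi * s / T) ^ (2 * n) \<le> ((cos (pi * \<delta> / T))\<^sup>2) ^ n"
    unfolding power_mult by (rule power_mono) simp
  have "4 ^ n / (2 * real n) \<le> real ((2 * n) choose n)"
    by (rule central_binomial_lower_bound[OF n])
  then have "4 ^ n / real ((2 * n) choose n) \<le> 2 * real n"
    using n by (simp add: field_simps)
  then have "cos_kernel n T s \<le> 2 * real n * ((cos (pi * \<delta> / T))\<^sup>2) ^ n"
    unfolding cos_kernel_def using le by (rule mult_mono) (auto simp: power_mult)
  then show ?thesis by (simp add: mult.assoc)
qed

section \<open>Parseval inequality and comparison of square integrals\<close>

text \<open>Because \<open>f 0 = f T\<close>, the convolutions of \<open>f\<close> with the cosine kernel converge to \<open>f\<close> uniformly on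
  the closed interval; the damped Fourier sums therefore exhaust the square integral of \<open>f\<close>.\<close>
lemma parseval_inequality:
  fixes f :: "real \<Rightarrow> 'a::complex_hilbert_space"
  assumes T: "T > 0" and cont: "continuous_on {0..T} f" and per: "f 0 = f T" and e: "e > 0"
  obtains K where "finite K"
    "integral {0..T} (\<lambda>s. (norm (f s))\<^sup>2) \<le> T * (\<Sum>k\<in>K. (norm (fourier_coeff T f k))\<^sup>2) + e"
proof -
  define \<epsilon> where "\<epsilon> = sqrt (e / T) / 2"
  have \<epsilon>: "\<epsilon> > 0"
    using e T by (simp add: \<epsilon>_def)
  have "uniformly_continuous_on {0..T} f"
    using cont by (intro compact_uniformly_continuous) auto
  then obtain \<delta>0 where \<delta>0: "\<delta>0 > 0"
    "\<And>s \<sigma>. s \<in> {0..T} \<Longrightarrow> \<sigma> \<in> {0..T} \<Longrightarrow> \<bar>s - \<sigma>\<bar> < \<delta>0 \<Longrightarrow> norm (f s - f \<sigma>) < \<epsilon> / 2"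
    unfolding uniformly_continuous_on_def dist_norm using \<epsilon>
    by (metis half_gt_zero real_norm_def norm_minus_commute)
  define \<delta> where "\<delta> = min \<delta>0 (T / 3)"
  have \<delta>: "0 < \<delta>" "\<delta> < T / 2" "\<delta> \<le> \<delta>0"
    using \<delta>0 T by (auto simp: \<delta>_def)
  \<comment> \<open>Where the kernel is not small, \<open>s\<close> and \<open>\<sigma>\<close> are either close to each other or close to
    opposite endpoints, and the values of \<open>f\<close> at the endpoints agree.\<close>
  have close: "norm (f \<sigma> - f s) \<le> \<epsilon>"
    if "s \<in> {0..T}" "\<sigma> \<in> {0..T}" "\<not> (\<delta> \<le> \<bar>s - \<sigma>\<bar> \<and> \<bar>s - \<sigma>\<bar> \<le> T - \<delta>)" for s \<sigma>
  proof -
    have wrap: "norm (f a - f b) \<le> \<epsilon>" if "a \<in> {0..T}" "b \<in> {0..T}" "a - b > T - \<delta>" for a b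
    proof -
      have "norm (f a - f b) \<le> norm (f a - f T) + norm (f 0 - f b)"
        using norm_triangle_ineq[of "f a - f T" "f 0 - f b"] per by simp
      also have "\<dots> \<le> \<epsilon> / 2 + \<epsilon> / 2"
        using that \<delta> T by (intro add_mono less_imp_le[OF \<delta>0(2)]) auto
      finally show ?thesis by simp
    qed
    show ?thesis
    proof (cases "\<bar>s - \<sigma>\<bar> < \<delta>")
      case True
      then show ?thesis
        using \<delta>0(2)[of s \<sigma>] that \<delta> \<epsilon> by (simp add: norm_minus_commute)
    next
      case False
      then show ?thesis
        using that wrap[of s \<sigma>] wrap[of \<sigma> s] by (auto simp: norm_minus_commute abs_if split: if_splits)
    qed
  qed
  obtain B where B: "B > 0" "\<And>s. s \<in> {0..T} \<Longrightarrow> norm (f s) \<le> B"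
    using compact_imp_bounded[OF compact_continuous_image[OF cont]] unfolding bounded_pos by auto
  define q where "q = (cos (pi * \<delta> / T))\<^sup>2"
  have q: "0 \<le> q" "q < 1"
  proof -
    have "cos (pi * \<delta> / T) < cos 0"
      by (rule cos_monotone_0_pi) (use \<delta> T in \<open>auto simp: field_simps\<close>)
    moreover have "cos (pi - pi * \<delta> / T) < cos (pi * \<delta> / T)"
      by (rule cos_monotone_0_pi) (use \<delta> T in \<open>auto simp: field_simps\<close>)
    ultimately have "\<bar>cos (pi * \<delta> / T)\<bar> < 1"
      by (auto simp: cos_diff)
    then show "0 \<le> q" "q < 1"
      by (simp_all add: q_def abs_square_less_1)
  qed
  have "(\<lambda>n. real n * q ^ n) \<longlonglongrightarrow> 0"
    using powser_times_n_limit_0[of q] q by simp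
  then have "(\<lambda>n. 4 * B * (real n * q ^ n)) \<longlonglongrightarrow> 4 * B * 0"
    by (intro tendsto_intros)
  then have "\<forall>\<^sub>F n in sequentially. 4 * B * (real n * q ^ n) < \<epsilon>"
    using \<epsilon> by (intro order_tendstoD(2)) auto
  then have "\<forall>\<^sub>F n in sequentially. 4 * B * (real n * q ^ n) < \<epsilon> \<and> n > 0"
    using eventually_gt_at_top[of 0] by eventually_elim auto
  then obtain n where n: "4 * B * (real n * q ^ n) < \<epsilon>" "n > 0"
    by (auto simp: eventually_sequentially)
  define K where "K = {- int n..int n}"
  define c where "c = cos_kernel_coeff n"
  define g where "g s = (\<Sum>k\<in>K. c k *\<^sub>R wave T k s *\<^sub>C fourier_coeff T f k)" for s
  have coeff: "(\<lambda>s. wave T k s *\<^sub>C f s) integrable_on {0..T}" for k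
    by (intro integrable_continuous_interval continuous_intros cont)
  have approx: "norm (f s - g s) \<le> 2 * \<epsilon>" if s: "s \<in> {0..T}" for s
  proof -
    have kernel: "((\<lambda>\<sigma>. cos_kernel n T (s - \<sigma>)) has_integral T) {0..T}"
      by (rule cos_kernel_has_integral[OF T])
    have "((\<lambda>\<sigma>. cos_kernel n T (s - \<sigma>) *\<^sub>R f \<sigma> - cos_kernel n T (s - \<sigma>) *\<^sub>R f s) has_integral
        T *\<^sub>R g s - T *\<^sub>R f s) {0..T}"
      unfolding g_def K_def c_def
      using has_integral_linear[OF kernel bounded_linear_scaleR_left]
      by (intro has_integral_diff cos_kernel_convolution_has_integral T coeff) (simp add: o_def)
    moreover have "((\<lambda>\<sigma>. \<epsilon> * cos_kernel n T (s - \<sigma>) + \<epsilon>) has_integral \<epsilon> * T + T * \<epsilon>) {0..T}"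
      using T has_integral_const_real[of \<epsilon> 0 T]
      by (intro has_integral_add has_integral_mult_right kernel) simp
    moreover have "norm (cos_kernel n T (s - \<sigma>) *\<^sub>R f \<sigma> - cos_kernel n T (s - \<sigma>) *\<^sub>R f s)
        \<le> \<epsilon> * cos_kernel n T (s - \<sigma>) + \<epsilon>" if \<sigma>: "\<sigma> \<in> {0..T}" for \<sigma>
    proof (cases "\<delta> \<le> \<bar>s - \<sigma>\<bar> \<and> \<bar>s - \<sigma>\<bar> \<le> T - \<delta>")
      case True
      have "norm (f \<sigma> - f s) \<le> 2 * B"
        using norm_triangle_ineq4[of "f \<sigma>" "f s"] B(2)[OF s] B(2)[OF \<sigma>] by simp
      moreover have "cos_kernel n T (s - \<sigma>) \<le> 2 * (real n * q ^ n)"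
        unfolding q_def using True by (intro cos_kernel_tail_bound T n \<delta>) auto
      ultimately have "cos_kernel n T (s - \<sigma>) * norm (f \<sigma> - f s) \<le> 2 * (real n * q ^ n) * (2 * B)"
        using q by (intro mult_mono) (auto simp: cos_kernel_nonneg)
      also have "\<dots> \<le> \<epsilon>"
        using n by (simp add: mult_ac)
      also have "\<dots> \<le> \<epsilon> * cos_kernel n T (s - \<sigma>) + \<epsilon>"
        using \<epsilon> by (simp add: cos_kernel_nonneg)
      finally show ?thesis
        by (simp add: cos_kernel_nonneg flip: scaleR_diff_right)
    next
      case False
      then have "cos_kernel n T (s - \<sigma>) * norm (f \<sigma> - f s) \<le> cos_kernel n T (s - \<sigma>) * \<epsilon>"
        by (intro mult_left_mono close s \<sigma> cos_kernel_nonneg) auto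
      then show ?thesis
        using \<epsilon> by (simp add: cos_kernel_nonneg mult.commute flip: scaleR_diff_right)
    qed
    ultimately have "norm (T *\<^sub>R g s - T *\<^sub>R f s) \<le> \<epsilon> * T + T * \<epsilon>"
      by (metis (no_types, lifting) has_integral_integrable integral_unique integral_norm_bound_integral)
    then have "T * norm (g s - f s) \<le> T * (2 * \<epsilon>)"
      using T by (simp add: algebra_simps flip: scaleR_diff_right)
    then show ?thesis
      using T by (simp add: norm_minus_commute)
  qed
  have square: "(\<lambda>s. (norm (f s))\<^sup>2) integrable_on {0..T}"
    by (intro integrable_continuous_interval continuous_intros cont)
  have dev: "((\<lambda>s. (norm (f s - g s))\<^sup>2) has_integral integral {0..T} (\<lambda>s. (norm (f s))\<^sup>2)
      - T * (\<Sum>k\<in>K. (2 * c k - (c k)\<^sup>2) * (norm (fourier_coeff T f k))\<^sup>2)) {0..T}"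
    unfolding g_def by (rule norm_diff_fourier_sum_has_integral[OF T _ square coeff]) (simp add: K_def)
  have "((\<lambda>s. (2 * \<epsilon>)\<^sup>2) has_integral T * (2 * \<epsilon>)\<^sup>2) {0..T}"
    using has_integral_const_real[of "(2 * \<epsilon>)\<^sup>2" 0 T] T by simp
  from has_integral_le[OF dev this power_mono[OF approx norm_ge_zero]]
  have "integral {0..T} (\<lambda>s. (norm (f s))\<^sup>2)
      \<le> T * (\<Sum>k\<in>K. (2 * c k - (c k)\<^sup>2) * (norm (fourier_coeff T f k))\<^sup>2) + T * (2 * \<epsilon>)\<^sup>2"
    by simp
  also have "T * (2 * \<epsilon>)\<^sup>2 = e"
    using T e by (simp add: \<epsilon>_def)
  also have "(\<Sum>k\<in>K. (2 * c k - (c k)\<^sup>2) * (norm (fourier_coeff T f k))\<^sup>2)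
      \<le> (\<Sum>k\<in>K. (norm (fourier_coeff T f k))\<^sup>2)"
  proof (rule sum_mono)
    fix k
    have "2 * c k - (c k)\<^sup>2 \<le> 1"
      using zero_le_power2[of "1 - c k"] by (simp add: power2_diff)
    then show "(2 * c k - (c k)\<^sup>2) * (norm (fourier_coeff T f k))\<^sup>2 \<le> (norm (fourier_coeff T f k))\<^sup>2"
      using mult_right_mono[of _ 1] by force
  qed
  finally show ?thesis
    using T by (intro that[of K]) (auto simp: K_def)
qed

text \<open>The substitute for Plancherel's theorem. The hypotheses on \<open>v\<close> are weaker than those on \<open>u\<close>
  because \<open>v\<close>, the derivative of a weight with a kink times an orbit, has a jump.\<close>
lemma L2_norm_le_by_fourier_coeffs:
  fixes u v :: "real \<Rightarrow> 'a::complex_hilbert_space"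
  assumes T: "T > 0" and r: "r > 0"
    and cont: "continuous_on {0..T} u" and per: "u 0 = u T"
    and square: "(\<lambda>s. (norm (v s))\<^sup>2) integrable_on {0..T}"
    and coeff: "\<And>k. (\<lambda>s. wave T k s *\<^sub>C v s) integrable_on {0..T}"
    and bound: "\<And>k. r * norm (fourier_coeff T u k) \<le> norm (fourier_coeff T v k)"
  shows "r\<^sup>2 * integral {0..T} (\<lambda>s. (norm (u s))\<^sup>2) \<le> integral {0..T} (\<lambda>s. (norm (v s))\<^sup>2)"
proof (rule field_le_epsilon)
  fix e :: real assume e: "e > 0"
  obtain K where K: "finite K"
    "integral {0..T} (\<lambda>s. (norm (u s))\<^sup>2)
      \<le> T * (\<Sum>k\<in>K. (norm (fourier_coeff T u k))\<^sup>2) + e / r\<^sup>2"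
    by (rule parseval_inequality[OF T cont per, of "e / r\<^sup>2"]) (use e r in auto)
  have "r\<^sup>2 * integral {0..T} (\<lambda>s. (norm (u s))\<^sup>2)
      \<le> r\<^sup>2 * (T * (\<Sum>k\<in>K. (norm (fourier_coeff T u k))\<^sup>2) + e / r\<^sup>2)"
    by (intro mult_left_mono K) simp
  also have "\<dots> = T * (\<Sum>k\<in>K. (r * norm (fourier_coeff T u k))\<^sup>2) + e"
    using r by (simp add: algebra_simps sum_distrib_left power_mult_distrib)
  also have "(\<Sum>k\<in>K. (r * norm (fourier_coeff T u k))\<^sup>2) \<le> (\<Sum>k\<in>K. (norm (fourier_coeff T v k))\<^sup>2)"
    using r by (intro sum_mono power_mono bound) auto
  also have "T * (\<Sum>k\<in>K. (norm (fourier_coeff T v k))\<^sup>2) \<le> integral {0..T} (\<lambda>s. (norm (v s))\<^sup>2)"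
    by (rule bessel_inequality[OF T K(1) square coeff])
  finally show "r\<^sup>2 * integral {0..T} (\<lambda>s. (norm (u s))\<^sup>2)
      \<le> integral {0..T} (\<lambda>s. (norm (v s))\<^sup>2) + e"
    using T by (simp add: mult_left_mono)
qed

section \<open>Weighted orbit estimate at an abscissa of exponential boundedness\<close>

lemma has_integral_if_le:
  fixes f g :: "real \<Rightarrow> 'b::banach"
  assumes "a \<le> t" "t \<le> b" "continuous_on {a..t} f" "continuous_on {t..b} g"
  shows "((\<lambda>s. if s \<le> t then f s else g s) has_integral integral {a..t} f + integral {t..b} g) {a..b}"
proof (rule has_integral_combine[OF assms(1,2)])
  show "((\<lambda>s. if s \<le> t then f s else g s) has_integral integral {a..t} f) {a..t}"
    using integrable_integral[OF integrable_continuous_interval[OF assms(3)]]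
    by (rule has_integral_eq[rotated]) auto
  show "((\<lambda>s. if s \<le> t then f s else g s) has_integral integral {t..b} g) {t..b}"
    by (rule has_integral_spike[OF _ _ integrable_integral[OF integrable_continuous_interval[OF assms(4)]],
          of "{t}"]) auto
qed

text \<open>The properties of a semigroup and its resolvent \<open>Q\<close> on the half-plane \<open>Re z > \<omega>\<close> on which the
  weighted estimates rest. The generator does not occur: its relation to \<open>S\<close> is expressed by the
  truncated Laplace transform of an orbit. In this form the properties pass to the adjoint
  semigroup by moving operators across inner products, and the estimates hold for both.\<close>
locale resolvent_bounded_semigroup =
  fixes S :: "real \<Rightarrow> 'a::complex_hilbert_space \<Rightarrow> 'a"
    and Q :: "complex \<Rightarrow> 'a \<Rightarrow> 'a"
    and \<omega> r :: real and m :: "real \<Rightarrow> real"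
  assumes S_clinear: "s \<ge> 0 \<Longrightarrow> bounded_clinear (S s)"
    and S_0: "S 0 x = x"
    and S_add: "s \<ge> 0 \<Longrightarrow> t \<ge> 0 \<Longrightarrow> S (s + t) x = S s (S t x)"
    and S_continuous: "continuous_on {0..} (\<lambda>s. S s x)"
    and m_continuous: "continuous_on {0..} m"
    and m_nonneg: "s \<ge> 0 \<Longrightarrow> m s \<ge> 0"
    and S_bound: "s \<ge> 0 \<Longrightarrow> norm (S s x) \<le> m s * norm x"
    and r_pos: "r > 0"
    and Q_clinear: "Re z > \<omega> \<Longrightarrow> bounded_clinear (Q z)"
    and Q_bound: "Re z > \<omega> \<Longrightarrow> r * norm (Q z x) \<le> norm x"
    and Q_commute: "Re z > \<omega> \<Longrightarrow> s \<ge> 0 \<Longrightarrow> Q z (S s x) = S s (Q z x)"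
    and Q_laplace: "Re z > \<omega> \<Longrightarrow> s \<ge> 0 \<Longrightarrow>
      ((\<lambda>\<sigma>. exp (- z * of_real \<sigma>) *\<^sub>C S \<sigma> x) has_integral
        Q z x - exp (- z * of_real s) *\<^sub>C S s (Q z x)) {0..s}"
begin

lemma S_continuous_interval [continuous_intros]: "0 \<le> a \<Longrightarrow> continuous_on {a..b} (\<lambda>s. S s x)"
  by (rule continuous_on_subset[OF S_continuous]) auto

text \<open>On orbits \<open>Q z\<close> inverts \<open>z - A\<close>, and \<open>A - z\<close> generates \<open>e\<^bsup>-zs\<^esup> S s\<close>; the claim follows from
  the truncated Laplace transform and the fundamental theorem of calculus.\<close>
lemma Q_orbit_has_derivative:
  assumes z: "Re z > \<omega>" and s: "0 \<le> a" "s \<in> {a..b}"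
  shows "((\<lambda>s. Q z (exp (- z * of_real s) *\<^sub>C S s x)) has_vector_derivative
           - (exp (- z * of_real s) *\<^sub>C S s x)) (at s within {a..b})"
proof -
  define G where "G s = exp (- z * of_real s) *\<^sub>C S s x" for s :: real
  have G: "continuous_on {0..b} G"
    unfolding G_def by (intro continuous_intros) auto
  have "((\<lambda>s. integral {0..s} G) has_vector_derivative G s) (at s within {a..b})"
    using integral_has_vector_derivative[OF G, of s] s
    by (auto intro: has_vector_derivative_within_subset)
  then have "((\<lambda>s. Q z x - integral {0..s} G) has_vector_derivative 0 - G s) (at s within {a..b})"
    by (intro derivative_intros) auto
  moreover have "Q z (G \<sigma>) = Q z x - integral {0..\<sigma>} G" if "\<sigma> \<in> {a..b}" for \<sigma>
    using integral_unique[OF Q_laplace[OF z, of \<sigma> x]] Q_clinear[OF z] Q_commute[OF z, of \<sigma> x] that s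
    by (simp add: G_def[abs_def] bounded_clinear_def)
  ultimately show ?thesis
    using s by (auto simp: G_def intro: has_vector_derivative_transform)
qed

text \<open>By the preceding lemma the derivative of \<open>\<phi> Q e\<^bsup>-zs\<^esup> S\<close> is \<open>\<phi>' Q e\<^bsup>-zs\<^esup> S - \<phi> e\<^bsup>-zs\<^esup> S\<close>.
  If \<open>\<phi>\<close> vanishes at both ends, the formula says that \<open>Q z\<close> maps the transform of \<open>\<phi>' S x\<close> to that
  of \<open>\<phi> S x\<close>.\<close>
lemma Q_orbit_integral_by_parts:
  assumes z: "Re z > \<omega>" and ab: "0 \<le> a" "a \<le> b"
    and \<phi>: "\<And>s. s \<in> {a..b} \<Longrightarrow> (\<phi> has_real_derivative \<phi>' s) (at s within {a..b})"
    and \<phi>': "continuous_on {a..b} \<phi>'"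
  shows "Q z (integral {a..b} (\<lambda>s. \<phi>' s *\<^sub>R exp (- z * of_real s) *\<^sub>C S s x)) =
    integral {a..b} (\<lambda>s. \<phi> s *\<^sub>R exp (- z * of_real s) *\<^sub>C S s x)
    + \<phi> b *\<^sub>R Q z (exp (- z * of_real b) *\<^sub>C S b x)
    - \<phi> a *\<^sub>R Q z (exp (- z * of_real a) *\<^sub>C S a x)"
proof -
  define G where "G s = exp (- z * of_real s) *\<^sub>C S s x" for s :: real
  have G: "continuous_on {a..b} G"
    unfolding G_def by (intro continuous_intros ab)
  have lin: "bounded_linear (Q z)"
    using Q_clinear[OF z] by (simp add: bounded_clinear_def)
  have "continuous_on {a..b} \<phi>"
    using \<phi> by (intro DERIV_continuous_on) auto
  then have int: "(\<lambda>s. \<phi> s *\<^sub>R G s) integrable_on {a..b}"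
    by (intro integrable_continuous_interval continuous_intros G)
  have int': "(\<lambda>s. \<phi>' s *\<^sub>R G s) integrable_on {a..b}"
    by (intro integrable_continuous_interval continuous_intros G \<phi>')
  have "((\<lambda>s. \<phi> s *\<^sub>R Q z (G s)) has_vector_derivative
      (\<phi> s *\<^sub>R (- G s) + \<phi>' s *\<^sub>R Q z (G s))) (at s within {a..b})" if "s \<in> {a..b}" for s
    unfolding G_def by (intro has_vector_derivative_scaleR \<phi> Q_orbit_has_derivative z ab that)
  then have "((\<lambda>s. \<phi> s *\<^sub>R (- G s) + \<phi>' s *\<^sub>R Q z (G s)) has_integral
      (\<phi> b *\<^sub>R Q z (G b) - \<phi> a *\<^sub>R Q z (G a))) {a..b}"
    by (intro fundamental_theorem_of_calculus ab) auto
  from has_integral_add[OF this integrable_integral[OF int]]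
  have parts: "((\<lambda>s. Q z (\<phi>' s *\<^sub>R G s)) has_integral
      (\<phi> b *\<^sub>R Q z (G b) - \<phi> a *\<^sub>R Q z (G a)) + integral {a..b} (\<lambda>s. \<phi> s *\<^sub>R G s)) {a..b}"
    by (simp add: linear_simps[OF lin])
  have "((\<lambda>s. Q z (\<phi>' s *\<^sub>R G s)) has_integral Q z (integral {a..b} (\<lambda>s. \<phi>' s *\<^sub>R G s))) {a..b}"
    using has_integral_linear[OF integrable_integral[OF int'] lin] by (simp add: o_def)
  from has_integral_unique[OF this parts] show ?thesis
    by (simp add: G_def algebra_simps)
qed

text \<open>The resolvent bound in integrated form. The weight \<open>\<Phi>\<close> is continued on \<open>[t, T]\<close> by the linear
  function that reaches zero at \<open>T\<close>, which makes \<open>u\<close> periodic; the boundary terms at the kink \<open>t\<close>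
  cancel in the two integrations by parts. The last integral is the price of the continuation.\<close>
lemma tapered_weight_estimate:
  assumes \<beta>: "\<beta> > \<omega>" and t: "0 < t" "t < T"
    and \<Phi>: "\<And>s. s \<in> {0..t} \<Longrightarrow> (\<Phi> has_real_derivative \<Phi>' s) (at s within {0..t})"
    and \<Phi>': "continuous_on {0..t} \<Phi>'" and \<Phi>0: "\<Phi> 0 = 0"
  shows "r\<^sup>2 * integral {0..t} (\<lambda>s. (norm (\<Phi> s *\<^sub>R exp (- \<beta> * s) *\<^sub>R S s x))\<^sup>2)
    \<le> integral {0..t} (\<lambda>s. (norm (\<Phi>' s *\<^sub>R exp (- \<beta> * s) *\<^sub>R S s x))\<^sup>2)
      + integral {t..T} (\<lambda>s. (norm ((- \<Phi> t / (T - t)) *\<^sub>R exp (- \<beta> * s) *\<^sub>R S s x))\<^sup>2)"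
proof -
  define E where "E s = exp (- \<beta> * s) *\<^sub>R S s x" for s
  define \<theta> where "\<theta> s = \<Phi> t / (T - t) * (T - s)" for s
  define \<theta>' where "\<theta>' = - \<Phi> t / (T - t)"
  define u where "u s = (if s \<le> t then \<Phi> s *\<^sub>R E s else \<theta> s *\<^sub>R E s)" for s
  define v where "v s = (if s \<le> t then \<Phi>' s *\<^sub>R E s else \<theta>' *\<^sub>R E s)" for s
  have E: "continuous_on {a..b} E" if "a \<ge> 0" for a b
    unfolding E_def using that by (intro continuous_intros)
  have \<Phi>_cont: "continuous_on {0..t} \<Phi>"
    using \<Phi> by (intro DERIV_continuous_on) auto
  have \<theta>_cont: "continuous_on A \<theta>" for A
    unfolding \<theta>_def by (intro continuous_intros)
  have \<theta>t: "\<theta> t = \<Phi> t"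
    using t by (simp add: \<theta>_def)
  note cont = E \<Phi>_cont \<theta>_cont \<Phi>'
  have u_cont: "continuous_on {0..T} u"
    unfolding u_def
  proof (rule continuous_on_cases_le)
    have split: "{s \<in> {0..T}. s \<le> t} = {0..t}" "{s \<in> {0..T}. t \<le> s} = {t..T}"
      using t by auto
    show "continuous_on {s \<in> {0..T}. s \<le> t} (\<lambda>s. \<Phi> s *\<^sub>R E s)"
      unfolding split by (intro continuous_on_scaleR cont) simp
    show "continuous_on {s \<in> {0..T}. t \<le> s} (\<lambda>s. \<theta> s *\<^sub>R E s)"
      unfolding split using t by (intro continuous_on_scaleR cont) simp
    show "continuous_on {0..T} (\<lambda>s::real. s)"
      by (rule continuous_on_id)
  qed (simp add: \<theta>t)
  have norm_v: "((\<lambda>s. (norm (v s))\<^sup>2) has_integral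
      integral {0..t} (\<lambda>s. (norm (\<Phi>' s *\<^sub>R E s))\<^sup>2) + integral {t..T} (\<lambda>s. (norm (\<theta>' *\<^sub>R E s))\<^sup>2)) {0..T}"
    unfolding v_def if_distrib[of "\<lambda>w. (norm w)\<^sup>2"] using t
    by (intro has_integral_if_le continuous_intros cont) auto
  have norm_u: "integral {0..t} (\<lambda>s. (norm (\<Phi> s *\<^sub>R E s))\<^sup>2) \<le> integral {0..T} (\<lambda>s. (norm (u s))\<^sup>2)"
  proof -
    have "integral {0..t} (\<lambda>s. (norm (\<Phi> s *\<^sub>R E s))\<^sup>2) = integral {0..t} (\<lambda>s. (norm (u s))\<^sup>2)"
      by (rule integral_cong) (simp add: u_def)
    also have "\<dots> \<le> integral {0..T} (\<lambda>s. (norm (u s))\<^sup>2)"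
      using t by (intro integral_subset_le integrable_continuous_interval continuous_intros
          continuous_on_subset[OF u_cont]) auto
    finally show ?thesis .
  qed
  have wave_u: "((\<lambda>s. wave T k s *\<^sub>C u s) has_integral
      integral {0..t} (\<lambda>s. wave T k s *\<^sub>C (\<Phi> s *\<^sub>R E s)) + integral {t..T} (\<lambda>s. wave T k s *\<^sub>C (\<theta> s *\<^sub>R E s)))
      {0..T}" for k
  proof -
    have "(\<lambda>s. wave T k s *\<^sub>C u s) =
        (\<lambda>s. if s \<le> t then wave T k s *\<^sub>C (\<Phi> s *\<^sub>R E s) else wave T k s *\<^sub>C (\<theta> s *\<^sub>R E s))"
      by (auto simp: u_def)
    then show ?thesis
      using t by (auto intro!: has_integral_if_le continuous_on_scaleC continuous_on_wave
          continuous_on_scaleR cont)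
  qed
  have wave_v: "((\<lambda>s. wave T k s *\<^sub>C v s) has_integral
      integral {0..t} (\<lambda>s. wave T k s *\<^sub>C (\<Phi>' s *\<^sub>R E s)) + integral {t..T} (\<lambda>s. wave T k s *\<^sub>C (\<theta>' *\<^sub>R E s)))
      {0..T}" for k
  proof -
    have "(\<lambda>s. wave T k s *\<^sub>C v s) =
        (\<lambda>s. if s \<le> t then wave T k s *\<^sub>C (\<Phi>' s *\<^sub>R E s) else wave T k s *\<^sub>C (\<theta>' *\<^sub>R E s))"
      by (auto simp: v_def)
    then show ?thesis
      using t by (auto intro!: has_integral_if_le continuous_on_scaleC continuous_on_wave
          continuous_on_scaleR continuous_on_const cont)
  qed
  have "r * norm (fourier_coeff T u k) \<le> norm (fourier_coeff T v k)" for k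
  proof -
    define z where "z = Complex \<beta> (2 * pi * of_int k / T)"
    have z: "Re z > \<omega>"
      using \<beta> by (simp add: z_def)
    \<comment> \<open>The \<open>k\<close>-th Fourier coefficient of a weighted orbit is a Laplace integral at \<open>z\<close>.\<close>
    have exp_z: "wave T (- k) s *\<^sub>C (c *\<^sub>R E s) = c *\<^sub>R exp (- z * of_real s) *\<^sub>C S s x" for c s
    proof -
      have "exp (- z * of_real s) = wave T (- k) s * of_real (exp (- \<beta> * s))"
        by (subst exp_eq_polar) (simp add: z_def wave_def mult.commute)
      then show ?thesis
        by (simp add: E_def scaleR_scaleC scaleC_scaleC mult_ac)
    qed
    have lin: "bounded_linear (Q z)"
      using Q_clinear[OF z] by (simp add: bounded_clinear_def)
    have "Q z (integral {0..t} (\<lambda>s. \<Phi>' s *\<^sub>R exp (- z * of_real s) *\<^sub>C S s x)) =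
        integral {0..t} (\<lambda>s. \<Phi> s *\<^sub>R exp (- z * of_real s) *\<^sub>C S s x)
        + \<Phi> t *\<^sub>R Q z (exp (- z * of_real t) *\<^sub>C S t x)"
      using Q_orbit_integral_by_parts[OF z _ _ \<Phi> \<Phi>'] t \<Phi>0 by simp
    moreover have "Q z (integral {t..T} (\<lambda>s. \<theta>' *\<^sub>R exp (- z * of_real s) *\<^sub>C S s x)) =
        integral {t..T} (\<lambda>s. \<theta> s *\<^sub>R exp (- z * of_real s) *\<^sub>C S s x)
        - \<Phi> t *\<^sub>R Q z (exp (- z * of_real t) *\<^sub>C S t x)"
    proof -
      have "(\<theta> has_real_derivative \<theta>') (at s within {t..T})" for s
        unfolding \<theta>_def \<theta>'_def using t by (auto intro!: derivative_eq_intros)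
      then show ?thesis
        using Q_orbit_integral_by_parts[OF z, of t T \<theta> "\<lambda>s. \<theta>'" x] t \<theta>t by (simp add: \<theta>_def)
    qed
    ultimately have "Q z (integral {0..T} (\<lambda>s. wave T (- k) s *\<^sub>C v s)) = integral {0..T} (\<lambda>s. wave T (- k) s *\<^sub>C u s)"
      unfolding integral_unique[OF wave_u] integral_unique[OF wave_v] exp_z linear_simps[OF lin] by simp
    then have "fourier_coeff T u k = Q z (fourier_coeff T v k)"
      by (simp add: fourier_coeff_def linear_simps[OF lin])
    then show ?thesis
      by (simp add: Q_bound[OF z])
  qed
  note coeffs = this
  have "u 0 = u T"
    using t \<Phi>0 by (simp add: u_def \<theta>_def)
  moreover have "T > 0"
    using t by simp
  ultimately have "r\<^sup>2 * integral {0..T} (\<lambda>s. (norm (u s))\<^sup>2) \<le> integral {0..T} (\<lambda>s. (norm (v s))\<^sup>2)"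
    by (intro L2_norm_le_by_fourier_coeffs r_pos u_cont coeffs has_integral_integrable[OF norm_v]
        has_integral_integrable[OF wave_v])
  moreover have "r\<^sup>2 * integral {0..t} (\<lambda>s. (norm (\<Phi> s *\<^sub>R E s))\<^sup>2) \<le> r\<^sup>2 * integral {0..T} (\<lambda>s. (norm (u s))\<^sup>2)"
    by (intro mult_left_mono norm_u) simp
  ultimately show ?thesis
    using integral_unique[OF norm_v] unfolding E_def \<theta>'_def by simp
qed

definition exp_bounded :: "real \<Rightarrow> bool" where
  "exp_bounded \<beta> \<longleftrightarrow> (\<exists>M. \<forall>s\<ge>0. \<forall>x. norm (S s x) \<le> M * exp (\<beta> * s) * norm x)"

text \<open>If \<open>e\<^bsup>-\<beta>s\<^esup> S s\<close> is bounded, the term due to the continuation of the weight is at most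
  \<open>C / (T - t)\<close> and vanishes as \<open>T\<close> tends to infinity.\<close>
lemma weight_estimate_if_exp_bounded:
  assumes \<beta>: "\<beta> > \<omega>" and bdd: "exp_bounded \<beta>" and t: "0 < t"
    and \<Phi>: "\<And>s. s \<in> {0..t} \<Longrightarrow> (\<Phi> has_real_derivative \<Phi>' s) (at s within {0..t})"
    and \<Phi>': "continuous_on {0..t} \<Phi>'" and \<Phi>0: "\<Phi> 0 = 0"
  shows "integral {0..t} (\<lambda>s. (r\<^sup>2 * (\<Phi> s)\<^sup>2 - (\<Phi>' s)\<^sup>2) * (exp (- 2 * \<beta> * s) * (norm (S s x))\<^sup>2)) \<le> 0"
proof -
  define E where "E s = exp (- \<beta> * s) *\<^sub>R S s x" for s
  have E: "continuous_on {a..b} E" if "a \<ge> 0" for a b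
    unfolding E_def using that by (intro continuous_intros)
  have \<Phi>_cont: "continuous_on {0..t} \<Phi>"
    using \<Phi> by (intro DERIV_continuous_on) auto
  obtain M where M: "\<And>s x. s \<ge> 0 \<Longrightarrow> norm (S s x) \<le> M * exp (\<beta> * s) * norm x"
    using bdd unfolding exp_bounded_def by blast
  have E_bound: "norm (E s) \<le> M * norm x" if "s \<ge> 0" for s
  proof -
    have "norm (E s) \<le> exp (- \<beta> * s) * (M * exp (\<beta> * s) * norm x)"
      unfolding E_def using M[OF that, of x] by simp
    also have "\<dots> = M * norm x"
      by (simp add: exp_minus field_simps)
    finally show ?thesis .
  qed
  define C where "C = (\<Phi> t)\<^sup>2 * (M * norm x)\<^sup>2"
  have "r\<^sup>2 * integral {0..t} (\<lambda>s. (norm (\<Phi> s *\<^sub>R E s))\<^sup>2) \<le> integral {0..t} (\<lambda>s. (norm (\<Phi>' s *\<^sub>R E s))\<^sup>2)"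
  proof (rule field_le_epsilon)
    fix e :: real assume e: "e > 0"
    define L where "L = (C + 1) / e"
    have C: "C \<ge> 0"
      by (simp add: C_def)
    have L: "L > 0"
      using e C by (simp add: L_def add_nonneg_pos)
    have "integral {t..t + L} (\<lambda>s. (norm ((- \<Phi> t / (t + L - t)) *\<^sub>R E s))\<^sup>2)
        \<le> integral {t..t + L} (\<lambda>s. C / L\<^sup>2)"
    proof (rule integral_le)
      show "(\<lambda>s. (norm ((- \<Phi> t / (t + L - t)) *\<^sub>R E s))\<^sup>2) integrable_on {t..t + L}"
        using t by (intro integrable_continuous_interval continuous_intros E) auto
      fix s assume "s \<in> {t..t + L}"
      then have "(norm (E s))\<^sup>2 \<le> (M * norm x)\<^sup>2"
        using t by (intro power_mono E_bound) auto
      then show "(norm ((- \<Phi> t / (t + L - t)) *\<^sub>R E s))\<^sup>2 \<le> C / L\<^sup>2"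
        by (simp add: C_def power_mult_distrib power_divide mult_left_mono divide_right_mono)
    qed auto
    also have "\<dots> = C / L"
      using L by (simp add: power2_eq_square)
    also have "\<dots> \<le> e"
      using e C L by (simp add: L_def field_simps)
    finally show "r\<^sup>2 * integral {0..t} (\<lambda>s. (norm (\<Phi> s *\<^sub>R E s))\<^sup>2)
        \<le> integral {0..t} (\<lambda>s. (norm (\<Phi>' s *\<^sub>R E s))\<^sup>2) + e"
      using tapered_weight_estimate[OF \<beta> t(1) _ \<Phi> \<Phi>' \<Phi>0, of "t + L" x] L
      unfolding E_def by linarith
  qed
  moreover have exp2: "exp (- 2 * \<beta> * s) = (exp (- \<beta> * s))\<^sup>2" for s
    by (simp flip: exp_double)
  ultimately have "integral {0..t} (\<lambda>s. r\<^sup>2 * (norm (\<Phi> s *\<^sub>R E s))\<^sup>2 - (norm (\<Phi>' s *\<^sub>R E s))\<^sup>2) \<le> 0"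
    by (subst integral_diff)
      (auto intro!: integrable_continuous_interval continuous_intros E \<Phi>_cont \<Phi>')
  also have "(\<lambda>s. r\<^sup>2 * (norm (\<Phi> s *\<^sub>R E s))\<^sup>2 - (norm (\<Phi>' s *\<^sub>R E s))\<^sup>2) =
      (\<lambda>s. (r\<^sup>2 * (\<Phi> s)\<^sup>2 - (\<Phi>' s)\<^sup>2) * (exp (- 2 * \<beta> * s) * (norm (S s x))\<^sup>2))"
    unfolding E_def exp2 by (simp add: fun_eq_iff power_mult_distrib algebra_simps)
  finally show ?thesis .
qed

end

section \<open>Exponential boundedness above the abscissa of the resolvent bound\<close>

context resolvent_bounded_semigroup
begin

lemma S_bound_interval:
  assumes "a \<ge> 0"
  shows "\<exists>B\<ge>1. \<forall>s\<in>{0..a}. \<forall>x. exp (\<gamma> * s) * norm (S s x) \<le> B * norm x"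
proof -
  have "continuous_on {0..a} (\<lambda>s. exp (\<gamma> * s) * m s)"
    by (intro continuous_intros continuous_on_subset[OF m_continuous]) auto
  from compact_imp_bounded[OF compact_continuous_image[OF this compact_Icc]]
  obtain B where B: "B > 0" "\<And>s. s \<in> {0..a} \<Longrightarrow> norm (exp (\<gamma> * s) * m s) \<le> B"
    unfolding bounded_pos by blast
  have "exp (\<gamma> * s) * norm (S s x) \<le> max B 1 * norm x" if "s \<in> {0..a}" for s x
  proof -
    have "exp (\<gamma> * s) * norm (S s x) \<le> exp (\<gamma> * s) * (m s * norm x)"
      using that by (intro mult_left_mono S_bound) auto
    also have "\<dots> = (exp (\<gamma> * s) * m s) * norm x"
      by simp
    also have "\<dots> \<le> max B 1 * norm x"
      using B(2)[OF that] by (intro mult_right_mono) auto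
    finally show ?thesis .
  qed
  then show ?thesis
    by (intro exI[of _ "max B 1"]) auto
qed

lemma exp_bounded_mono:
  assumes "exp_bounded \<beta>" "\<beta> \<le> \<gamma>"
  shows "exp_bounded \<gamma>"
proof -
  obtain M where M: "\<And>s x. s \<ge> 0 \<Longrightarrow> norm (S s x) \<le> M * exp (\<beta> * s) * norm x"
    using assms(1) unfolding exp_bounded_def by blast
  have "norm (S s x) \<le> max M 0 * exp (\<gamma> * s) * norm x" if s: "s \<ge> 0" for s x
  proof -
    have "norm (S s x) \<le> M * exp (\<beta> * s) * norm x"
      by (rule M[OF s])
    also have "\<dots> \<le> max M 0 * exp (\<gamma> * s) * norm x"
      using assms(2) s by (intro mult_right_mono mult_mono) (auto intro: mult_right_mono)
    finally show ?thesis .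
  qed
  then show ?thesis
    unfolding exp_bounded_def by blast
qed

text \<open>A bound \<open>B\<close> on \<open>[0, 1]\<close> gives the bound \<open>B\<^bsup>n+1\<^esup>\<close> on \<open>[0, n + 1]\<close> by the semigroup law.\<close>
lemma exp_bounded_exists: "\<exists>\<beta>. exp_bounded \<beta>"
proof -
  obtain B where B: "B \<ge> 1" "\<And>s x. s \<in> {0..1} \<Longrightarrow> exp (0 * s) * norm (S s x) \<le> B * norm x"
    using S_bound_interval[OF zero_le_one, of 0] by blast
  have step: "norm (S s x) \<le> B ^ Suc n * norm x" if "0 \<le> s" "s \<le> real (Suc n)" for n s x
    using that
  proof (induction n arbitrary: s)
    case 0
    then show ?case using B(2)[of s x] by simp
  next
    case (Suc n)
    show ?case
    proof (cases "s \<le> 1")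
      case True
      then have "norm (S s x) \<le> B * norm x"
        using B(2)[of s x] Suc by simp
      also have "\<dots> \<le> B ^ Suc (Suc n) * norm x"
        using B(1) power_increasing[of 1 "Suc (Suc n)" B] by (intro mult_right_mono) auto
      finally show ?thesis .
    next
      case False
      have "norm (S s x) = norm (S 1 (S (s - 1) x))"
        using S_add[of 1 "s - 1" x] False by simp
      also have "\<dots> \<le> B * norm (S (s - 1) x)"
        using B(2)[of 1] by simp
      also have "\<dots> \<le> B * (B ^ Suc n * norm x)"
        using Suc False B(1) by (intro mult_left_mono Suc.IH) auto
      finally show ?thesis by (simp add: mult_ac)
    qed
  qed
  have "norm (S s x) \<le> B * exp (ln B * s) * norm x" if s: "s \<ge> 0" for s x
  proof -
    define n where "n = nat \<lfloor>s\<rfloor>"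
    have n: "real n \<le> s" "s \<le> real (Suc n)"
      using s by (auto simp: n_def) linarith
    have "norm (S s x) \<le> B ^ Suc n * norm x"
      by (rule step[OF s n(2)])
    also have "B ^ n = exp (ln B * real n)"
      using B(1) by (simp add: exp_of_nat2_mult)
    then have "B ^ Suc n * norm x \<le> B * exp (ln B * s) * norm x"
      using n(1) B(1) by (auto intro!: mult_right_mono mult_left_mono)
    finally show ?thesis .
  qed
  then show ?thesis
    unfolding exp_bounded_def by blast
qed

text \<open>For \<open>\<Phi> s = s e\<^bsup>\<delta>s\<^esup>\<close> with \<open>\<delta> = r/2\<close> one has
  \<open>r\<^sup>2 \<Phi>\<^sup>2 - \<Phi>'\<^sup>2 = q s e\<^bsup>2\<delta>s\<^esup>\<close>, where \<open>q\<close> is quadratic with positive leading coefficient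
  \<open>r\<^sup>2 - \<delta>\<^sup>2\<close>. The factor \<open>e\<^bsup>2\<delta>s\<^esup>\<close> lowers the exponent of the weighted orbit from \<open>\<beta>\<close> to \<open>\<beta> - \<delta>\<close>,
  so the weighted estimate bounds the square integral at the lower exponent by its part over
  a bounded interval.\<close>
lemma weighted_square_integral_bound:
  assumes \<beta>: "\<beta> > \<omega>" and bdd: "exp_bounded \<beta>"
  shows "\<exists>C\<ge>0. \<forall>\<tau>\<ge>0. \<forall>x.
    integral {0..\<tau>} (\<lambda>s. exp (- 2 * (\<beta> - r / 2) * s) * (norm (S s x))\<^sup>2) \<le> C * (norm x)\<^sup>2"
proof -
  define \<delta> where "\<delta> = r / 2"
  define \<gamma> where "\<gamma> = \<beta> - \<delta>"
  define W where "W x s = exp (- 2 * \<gamma> * s) * (norm (S s x))\<^sup>2" for x s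
  define q where "q s = r\<^sup>2 * s\<^sup>2 - (1 + \<delta> * s)\<^sup>2" for s
  \<comment> \<open>As \<open>q s = 3/4 y\<^sup>2 - y - 1\<close> with \<open>y = r s\<close>, one has \<open>q \<ge> -2\<close> everywhere and \<open>q \<ge> 1\<close> for \<open>y \<ge> 4\<close>.\<close>
  define a where "a = 4 / r"
  have a: "a > 0"
    using r_pos by (simp add: a_def)
  have W_cont: "continuous_on {c..b} (W x)" if "c \<ge> 0" for b c x
    unfolding W_def using that by (intro continuous_intros)
  have W_nonneg: "W x s \<ge> 0" for x s
    by (simp add: W_def)
  have q_cont: "continuous_on A q" for A
    unfolding q_def by (intro continuous_intros)
  have q_eq: "q s = (r * s)\<^sup>2 * (3/4) - r * s - 1" for s
    by (simp add: q_def \<delta>_def power2_eq_square algebra_simps)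
  have q_lower: "q s \<ge> - 2" for s
    using zero_le_power2[of "r * s * 3 / 2 - 1"] unfolding q_eq power2_eq_square by (simp add: algebra_simps)
  have q_large: "q s \<ge> 1" if "s \<ge> a" for s
  proof -
    have y: "r * s \<ge> 4"
      using that r_pos by (simp add: a_def field_simps)
    then have "(r * s) * (r * s) \<ge> 4 * (r * s)"
      by (intro mult_right_mono) auto
    then show ?thesis
      using y unfolding q_eq power2_eq_square by simp
  qed
  have qW: "integral {0..\<tau>} (\<lambda>s. q s * W x s) \<le> 0" if "\<tau> > 0" for \<tau> x
  proof -
    have "((\<lambda>s. s * exp (\<delta> * s)) has_real_derivative (1 + \<delta> * s) * exp (\<delta> * s)) (at s within {0..\<tau>})" for s
      by (auto intro!: derivative_eq_intros simp: algebra_simps)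
    moreover have "continuous_on {0..\<tau>} (\<lambda>s. (1 + \<delta> * s) * exp (\<delta> * s))"
      by (intro continuous_intros)
    ultimately have "integral {0..\<tau>} (\<lambda>s. (r\<^sup>2 * (s * exp (\<delta> * s))\<^sup>2 - ((1 + \<delta> * s) * exp (\<delta> * s))\<^sup>2)
        * (exp (- 2 * \<beta> * s) * (norm (S s x))\<^sup>2)) \<le> 0"
      by (intro weight_estimate_if_exp_bounded \<beta> bdd that) auto
    also have "(\<lambda>s. (r\<^sup>2 * (s * exp (\<delta> * s))\<^sup>2 - ((1 + \<delta> * s) * exp (\<delta> * s))\<^sup>2)
        * (exp (- 2 * \<beta> * s) * (norm (S s x))\<^sup>2)) = (\<lambda>s. q s * W x s)"
    proof
      fix s
      have "exp (- 2 * \<gamma> * s) = (exp (\<delta> * s))\<^sup>2 * exp (- 2 * \<beta> * s)"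
        by (simp add: \<gamma>_def algebra_simps flip: exp_double exp_add)
      then show "(r\<^sup>2 * (s * exp (\<delta> * s))\<^sup>2 - ((1 + \<delta> * s) * exp (\<delta> * s))\<^sup>2)
        * (exp (- 2 * \<beta> * s) * (norm (S s x))\<^sup>2) = q s * W x s"
        unfolding q_def W_def by (simp only: power_mult_distrib) (simp add: algebra_simps)
    qed
    finally show ?thesis .
  qed
  obtain B where B: "B \<ge> 1" "\<And>s x. s \<in> {0..a} \<Longrightarrow> exp (- \<gamma> * s) * norm (S s x) \<le> B * norm x"
    using S_bound_interval[OF less_imp_le[OF a], of "- \<gamma>"] by blast
  have W_a: "integral {0..a} (W x) \<le> a * (B * norm x)\<^sup>2" for x
  proof -
    have "W x s \<le> (B * norm x)\<^sup>2" if "s \<in> {0..a}" for s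
    proof -
      have "W x s = (exp (- \<gamma> * s) * norm (S s x))\<^sup>2"
        by (simp add: W_def power_mult_distrib flip: exp_double)
      also have "\<dots> \<le> (B * norm x)\<^sup>2"
        by (intro power_mono B that) simp
      finally show ?thesis .
    qed
    then have "integral {0..a} (W x) \<le> integral {0..a} (\<lambda>s. (B * norm x)\<^sup>2)"
      by (intro integral_le integrable_continuous_interval W_cont) auto
    then show ?thesis
      using a by simp
  qed
  have "integral {0..\<tau>} (W x) \<le> (3 * a * B\<^sup>2) * (norm x)\<^sup>2" if \<tau>: "\<tau> \<ge> 0" for \<tau> x
  proof -
    have W_int: "W x integrable_on {c..b}" if "c \<ge> 0" for c b
      by (intro integrable_continuous_interval W_cont that)
    have qW_int: "(\<lambda>s. q s * W x s) integrable_on {c..b}" if "c \<ge> 0" for c b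
      by (intro integrable_continuous_interval continuous_intros q_cont W_cont that)
    have nonneg: "integral {c..b} (W x) \<ge> 0" if "c \<ge> 0" for c b
      by (intro integral_nonneg W_int that W_nonneg)
    have "integral {0..\<tau>} (W x) \<le> 3 * integral {0..a} (W x)"
    proof (cases "\<tau> \<le> a")
      case True
      then have "integral {0..\<tau>} (W x) \<le> integral {0..a} (W x)"
        by (intro integral_subset_le W_int) (auto simp: W_nonneg)
      then show ?thesis
        using nonneg[of 0 a] by simp
    next
      case False
      have "integral {0..\<tau>} (\<lambda>s. q s * W x s) =
          integral {0..a} (\<lambda>s. q s * W x s) + integral {a..\<tau>} (\<lambda>s. q s * W x s)"
        using Henstock_Kurzweil_Integration.integral_combine[of 0 a \<tau> "\<lambda>s. q s * W x s"] False a qW_int[of 0 \<tau>] by simp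
      moreover have "integral {0..a} (\<lambda>s. q s * W x s) \<ge> integral {0..a} (\<lambda>s. (- 2) * W x s)"
        by (intro integral_le qW_int mult_right_mono q_lower W_nonneg integrable_continuous_interval
            continuous_intros W_cont) auto
      moreover have "integral {a..\<tau>} (\<lambda>s. q s * W x s) \<ge> integral {a..\<tau>} (W x)"
        using a mult_right_mono[OF q_large W_nonneg[of x]] by (intro integral_le qW_int W_int) auto
      moreover have "integral {0..\<tau>} (W x) = integral {0..a} (W x) + integral {a..\<tau>} (W x)"
        using Henstock_Kurzweil_Integration.integral_combine[of 0 a \<tau> "W x"] False a W_int[of 0 \<tau>] by simp
      ultimately show ?thesis
        using qW[of \<tau> x] False a by simp
    qed
    also have "\<dots> \<le> 3 * (a * (B * norm x)\<^sup>2)"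
      using W_a[of x] by simp
    finally show ?thesis
      by (simp add: power_mult_distrib)
  qed
  then show ?thesis
    using a unfolding W_def[abs_def] \<gamma>_def \<delta>_def by (intro exI[of _ "3 * a * B\<^sup>2"]) simp
qed

text \<open>Up to a constant, \<open>\<parallel>S s x\<parallel>\<close> is at most \<open>\<parallel>S \<tau> x\<parallel>\<close> for all \<open>\<tau>\<close> in \<open>[s - 1, s]\<close>. Averaging over
  \<open>\<tau>\<close> turns the uniform bound on square integrals into a pointwise bound.\<close>
lemma exp_bounded_step:
  assumes \<beta>: "\<beta> > \<omega>" and bdd: "exp_bounded \<beta>"
  shows "exp_bounded (\<beta> - r / 2)"
proof -
  define \<gamma> where "\<gamma> = \<beta> - r / 2"
  define W where "W x s = exp (- 2 * \<gamma> * s) * (norm (S s x))\<^sup>2" for x s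
  have W_eq: "W x s = (exp (- \<gamma> * s) * norm (S s x))\<^sup>2" for x s
    by (simp add: W_def power_mult_distrib flip: exp_double)
  have W_cont: "continuous_on {c..b} (W x)" if "c \<ge> 0" for b c x
    unfolding W_def using that by (intro continuous_intros)
  have W_int: "W x integrable_on {c..b}" if "c \<ge> 0" for c b x
    by (intro integrable_continuous_interval W_cont that)
  have "\<exists>C\<ge>0. \<forall>\<tau>\<ge>0. \<forall>x. integral {0..\<tau>} (W x) \<le> C * (norm x)\<^sup>2"
    unfolding W_def[abs_def] \<gamma>_def by (rule weighted_square_integral_bound[OF assms])
  then obtain C where C: "C \<ge> 0" "\<And>\<tau> x. \<tau> \<ge> 0 \<Longrightarrow> integral {0..\<tau>} (W x) \<le> C * (norm x)\<^sup>2"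
    by blast
  obtain B where B: "B \<ge> 1" "\<And>s x. s \<in> {0..1} \<Longrightarrow> exp (- \<gamma> * s) * norm (S s x) \<le> B * norm x"
    using S_bound_interval[OF zero_le_one, of "- \<gamma>"] by blast
  have W_le: "W x s \<le> B\<^sup>2 * (C + 1) * (norm x)\<^sup>2" if s: "s \<ge> 0" for s x
  proof (cases "s \<le> 1")
    case True
    have "W x s \<le> (B * norm x)\<^sup>2"
      unfolding W_eq using s True by (intro power_mono B) auto
    also have "\<dots> \<le> B\<^sup>2 * (C + 1) * (norm x)\<^sup>2"
      using C(1) by (simp add: power_mult_distrib algebra_simps)
    finally show ?thesis .
  next
    case False
    have W_shift: "W x s \<le> B\<^sup>2 * W x \<tau>" if \<tau>: "\<tau> \<in> {s - 1..s}" for \<tau>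
    proof -
      have "exp (- \<gamma> * s) * norm (S s x) =
          exp (- \<gamma> * \<tau>) * (exp (- \<gamma> * (s - \<tau>)) * norm (S (s - \<tau>) (S \<tau> x)))"
      proof -
        have "exp (- \<gamma> * s) = exp (- \<gamma> * \<tau>) * exp (- \<gamma> * (s - \<tau>))"
          unfolding exp_add[symmetric] by (simp add: algebra_simps)
        moreover have "S s x = S (s - \<tau>) (S \<tau> x)"
          using S_add[of "s - \<tau>" \<tau> x] \<tau> False by simp
        ultimately show ?thesis
          by (simp only: mult.assoc)
      qed
      also have "\<dots> \<le> exp (- \<gamma> * \<tau>) * (B * norm (S \<tau> x))"
        using \<tau> by (intro mult_left_mono B) auto
      finally have "(exp (- \<gamma> * s) * norm (S s x))\<^sup>2 \<le> (B * (exp (- \<gamma> * \<tau>) * norm (S \<tau> x)))\<^sup>2"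
        by (intro power_mono) (auto simp: mult_ac)
      then show ?thesis
        unfolding W_eq by (simp add: power_mult_distrib)
    qed
    have "integral {s - 1..s} (\<lambda>\<tau>. W x s) \<le> integral {s - 1..s} (\<lambda>\<tau>. B\<^sup>2 * W x \<tau>)"
      using False by (intro integral_le W_shift integrable_continuous_interval continuous_intros W_cont) auto
    then have "W x s \<le> B\<^sup>2 * integral {s - 1..s} (W x)"
      by simp
    also have "\<dots> \<le> B\<^sup>2 * integral {0..s} (W x)"
      using False by (intro mult_left_mono integral_subset_le W_int) (auto simp: W_def)
    also have "\<dots> \<le> B\<^sup>2 * (C * (norm x)\<^sup>2)"
      using s by (intro mult_left_mono C) auto
    also have "\<dots> \<le> B\<^sup>2 * (C + 1) * (norm x)\<^sup>2"
      by (simp add: algebra_simps)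
    finally show ?thesis .
  qed
  have "norm (S s x) \<le> (B * sqrt (C + 1)) * exp (\<gamma> * s) * norm x" if s: "s \<ge> 0" for s x
  proof -
    have "(B * sqrt (C + 1) * norm x)\<^sup>2 = B\<^sup>2 * (C + 1) * (norm x)\<^sup>2"
      using C(1) by (simp add: power_mult_distrib)
    then have "(exp (- \<gamma> * s) * norm (S s x))\<^sup>2 \<le> (B * sqrt (C + 1) * norm x)\<^sup>2"
      using W_le[OF s, of x] by (simp only: W_eq)
    moreover have "0 \<le> B * sqrt (C + 1) * norm x"
      using B(1) C(1) by simp
    ultimately have "exp (- \<gamma> * s) * norm (S s x) \<le> B * sqrt (C + 1) * norm x"
      by (rule power2_le_imp_le)
    then have "exp (\<gamma> * s) * (exp (- \<gamma> * s) * norm (S s x)) \<le> exp (\<gamma> * s) * (B * sqrt (C + 1) * norm x)"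
      by (intro mult_left_mono) auto
    moreover have "exp (\<gamma> * s) * (exp (- \<gamma> * s) * norm (S s x)) = norm (S s x)"
      by (simp flip: mult.assoc exp_add)
    ultimately show ?thesis
      by (simp only: mult_ac)
  qed
  then show ?thesis
    unfolding exp_bounded_def \<gamma>_def by blast
qed

lemma exp_bounded_above_abscissa:
  assumes "\<beta> > \<omega>"
  shows "exp_bounded \<beta>"
proof -
  obtain \<beta>0 where \<beta>0: "exp_bounded \<beta>0"
    using exp_bounded_exists by blast
  have "exp_bounded \<beta>" if "\<beta> > \<omega>" "\<beta> \<ge> \<beta>0 - real n * (r / 2)" for n \<beta>
    using that
  proof (induction n arbitrary: \<beta>)
    case 0
    then show ?case using exp_bounded_mono[OF \<beta>0] by simp
  next
    case (Suc n)
    then have "exp_bounded (\<beta> + r / 2)"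
      using r_pos by (intro Suc.IH) (auto simp: algebra_simps add_divide_distrib)
    then show ?case
      using exp_bounded_step[of "\<beta> + r / 2"] Suc r_pos by simp
  qed
  moreover obtain n where "(\<beta>0 - \<beta>) / (r / 2) \<le> real n"
    using real_arch_simple by blast
  then have "\<beta> \<ge> \<beta>0 - real n * (r / 2)"
    using r_pos by (simp add: field_simps)
  ultimately show ?thesis
    using assms by blast
qed

text \<open>For fixed \<open>t\<close> the integral depends continuously on the exponent, so the estimate passes from
  \<open>\<beta> > \<omega>\<close> to the limit \<open>\<omega>\<close>.\<close>
lemma weight_estimate:
  assumes t: "0 < t"
    and \<Phi>: "\<And>s. s \<in> {0..t} \<Longrightarrow> (\<Phi> has_real_derivative \<Phi>' s) (at s within {0..t})"
    and \<Phi>': "continuous_on {0..t} \<Phi>'" and \<Phi>0: "\<Phi> 0 = 0"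
  shows "integral {0..t} (\<lambda>s. (r\<^sup>2 * (\<Phi> s)\<^sup>2 - (\<Phi>' s)\<^sup>2) * (exp (- 2 * \<omega> * s) * (norm (S s x))\<^sup>2)) \<le> 0"
proof -
  define F where "F \<beta> = integral {0..t} (\<lambda>s. (r\<^sup>2 * (\<Phi> s)\<^sup>2 - (\<Phi>' s)\<^sup>2) * (exp (- 2 * \<beta> * s) * (norm (S s x))\<^sup>2))" for \<beta>
  have \<Phi>_cont: "continuous_on {0..t} \<Phi>"
    using \<Phi> by (intro DERIV_continuous_on) auto
  have proj: "continuous_on (UNIV \<times> {0..t}) (\<lambda>p. f (snd p))"
    if "continuous_on {0..t} f" for f :: "real \<Rightarrow> real"
    by (rule continuous_on_compose2[OF that continuous_on_snd[OF continuous_on_id]]) auto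
  have "continuous_on (UNIV \<times> cbox 0 t)
      (\<lambda>(\<beta>, s). (r\<^sup>2 * (\<Phi> s)\<^sup>2 - (\<Phi>' s)\<^sup>2) * (exp (- 2 * \<beta> * s) * (norm (S s x))\<^sup>2))"
    unfolding case_prod_beta cbox_interval
    by (intro continuous_on_mult continuous_on_diff continuous_on_power continuous_on_exp
        continuous_on_const continuous_on_fst continuous_on_snd continuous_on_id
        proj[OF \<Phi>_cont] proj[OF \<Phi>'] proj[OF continuous_on_norm[OF S_continuous_interval]]) simp
  then have "continuous_on UNIV F"
    unfolding F_def box_real(2)[symmetric] by (rule integral_continuous_on_param)
  then have "(F \<longlongrightarrow> F \<omega>) (at \<omega>)"
    by (simp add: continuous_on_def)
  then have "(F \<longlongrightarrow> F \<omega>) (at_right \<omega>)"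
    by (rule tendsto_within_subset) simp
  moreover have "\<forall>\<^sub>F \<beta> in at_right \<omega>. F \<beta> \<le> 0"
    unfolding F_def eventually_at_right_field
    by (intro exI[of _ "\<omega> + 1"] conjI allI impI weight_estimate_if_exp_bounded
        exp_bounded_above_abscissa t \<Phi> \<Phi>' \<Phi>0) auto
  ultimately have "F \<omega> \<le> 0"
    by (rule tendsto_upperbound) simp
  then show ?thesis
    by (simp add: F_def)
qed

end

section \<open>Riesz representation and adjoints\<close>

text \<open>By the parallelogram law a minimising sequence is a Cauchy sequence.\<close>
lemma min_norm_in_closed_convex:
  fixes C :: "'b::{real_inner, complete_space} set"
  assumes "closed C" "convex C" "C \<noteq> {}"
  obtains x where "x \<in> C" "\<And>y. y \<in> C \<Longrightarrow> norm x \<le> norm y"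
proof -
  define D where "D = Inf ((\<lambda>x. (norm x)\<^sup>2) ` C)"
  have bdd: "bdd_below ((\<lambda>x. (norm x)\<^sup>2) ` C)"
    by (rule bdd_belowI[of _ 0]) auto
  have D_le: "D \<le> (norm x)\<^sup>2" if "x \<in> C" for x
    unfolding D_def using that by (intro cInf_lower bdd) auto
  have "\<exists>x\<in>C. (norm x)\<^sup>2 < D + inverse (real (Suc n))" for n
    using cInf_less_iff[OF _ bdd, of "D + inverse (real (Suc n))"] assms(3) by (auto simp: D_def)
  then obtain X where X: "\<And>n. X n \<in> C" "\<And>n. (norm (X n))\<^sup>2 < D + inverse (real (Suc n))"
    by metis
  have dist_sq: "(norm (X i - X j))\<^sup>2 \<le> 2 * inverse (real (Suc i)) + 2 * inverse (real (Suc j))" for i j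
  proof -
    have "(1/2) *\<^sub>R X i + (1/2) *\<^sub>R X j \<in> C"
      using assms(2) X(1) by (intro convexD) auto
    then have "D \<le> (norm ((1/2) *\<^sub>R X i + (1/2) *\<^sub>R X j))\<^sup>2"
      by (rule D_le)
    moreover have "(norm (X i - X j))\<^sup>2 = 2 * (norm (X i))\<^sup>2 + 2 * (norm (X j))\<^sup>2
        - 4 * (norm ((1/2) *\<^sub>R X i + (1/2) *\<^sub>R X j))\<^sup>2"
      by (simp add: power2_norm_eq_inner inner_diff_left inner_diff_right inner_add_left
          inner_add_right inner_commute)
    ultimately show ?thesis
      using X(2)[of i] X(2)[of j] by linarith
  qed
  have "Cauchy X"
  proof (rule metric_CauchyI)
    fix e :: real assume e: "e > 0"
    obtain N where N: "inverse (real (Suc N)) < e\<^sup>2 / 4"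
      using reals_Archimedean[of "e\<^sup>2 / 4"] e by auto
    have "dist (X i) (X j) < e" if "i \<ge> N" "j \<ge> N" for i j
    proof -
      have inv: "inverse (real (Suc k)) \<le> inverse (real (Suc N))" if "k \<ge> N" for k
        using that by (intro le_imp_inverse_le) auto
      have "(norm (X i - X j))\<^sup>2 < e\<^sup>2"
        using dist_sq[of i j] N inv[OF that(1)] inv[OF that(2)] by linarith
      then show ?thesis
        using e by (auto simp: dist_norm intro: power2_less_imp_less)
    qed
    then show "\<exists>N. \<forall>i\<ge>N. \<forall>j\<ge>N. dist (X i) (X j) < e"
      by blast
  qed
  then obtain x where x: "X \<longlonglongrightarrow> x"
    using Cauchy_convergent convergent_def by blast
  have "x \<in> C"
    using closed_sequentially[OF assms(1)] X(1) x by blast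
  moreover have "norm x \<le> norm y" if "y \<in> C" for y
  proof -
    have "(\<lambda>n. D + inverse (real (Suc n))) \<longlonglongrightarrow> D + 0"
      by (intro tendsto_intros LIMSEQ_inverse_real_of_nat)
    then have "(norm x)\<^sup>2 \<le> D + 0"
      using X(2) by (intro LIMSEQ_le[OF tendsto_power[OF tendsto_norm[OF x]]])
        (auto intro: less_imp_le)
    also have "\<dots> \<le> (norm y)\<^sup>2"
      using D_le[OF that] by simp
    finally show ?thesis
      by (rule power2_le_imp_le) simp
  qed
  ultimately show ?thesis by (rule that)
qed

lemma inner_zero_if_norm_minimal:
  fixes x v :: "'b::real_inner"
  assumes "\<And>s. norm x \<le> norm (x + s *\<^sub>R v)"
  shows "inner x v = 0"
proof (cases "v = 0")
  case False
  define s where "s = - inner x v / inner v v"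
  have vv: "inner v v > 0"
    using False by simp
  have "(norm x)\<^sup>2 \<le> (norm (x + s *\<^sub>R v))\<^sup>2"
    by (intro power_mono assms) simp
  also have "\<dots> = (norm x)\<^sup>2 + 2 * s * inner x v + s * (s * inner v v)"
    by (simp add: power2_norm_eq_inner inner_add_left inner_add_right inner_commute algebra_simps)
  also have "s * inner v v = - inner x v"
    using vv by (simp add: s_def)
  finally have "s * inner x v \<ge> 0"
    by simp
  then have "(inner x v)\<^sup>2 \<le> 0"
    using vv by (simp add: s_def power2_eq_square divide_le_0_iff zero_le_divide_iff field_simps)
  then show ?thesis by simp
qed simp

text \<open>The element of minimal norm in the hyperplane \<open>f = 1\<close> is orthogonal to the kernel of \<open>f\<close>.\<close>
lemma riesz_representation:
  fixes f :: "'b::{real_inner, complete_space} \<Rightarrow> real"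
  assumes "bounded_linear f"
  obtains y where "\<And>x. f x = inner x y"
proof (cases "\<exists>x. f x \<noteq> 0")
  case False
  then show ?thesis using that[of 0] by simp
next
  case True
  note lin = linear_simps[OF assms]
  define C where "C = f -` {1}"
  have "closed C"
    unfolding C_def using linear_continuous_on[OF assms, of UNIV]
    by (intro continuous_closed_vimage) (auto simp: continuous_on_eq_continuous_at)
  moreover have "convex C"
    by (auto simp: convex_def C_def lin)
  moreover obtain x1 where "f x1 \<noteq> 0"
    using True by blast
  then have "x1 /\<^sub>R f x1 \<in> C"
    by (simp add: C_def lin)
  then have "C \<noteq> {}" by blast
  ultimately obtain x0 where x0: "x0 \<in> C" "\<And>y. y \<in> C \<Longrightarrow> norm x0 \<le> norm y"
    using min_norm_in_closed_convex[of C] by blast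
  have fx0: "f x0 = 1"
    using x0(1) by (simp add: C_def)
  then have pos: "inner x0 x0 > 0"
    using lin(3) by (cases "x0 = 0") (auto simp: lin)
  have "f x = inner x (x0 /\<^sub>R inner x0 x0)" for x
  proof -
    have "inner x0 (x - f x *\<^sub>R x0) = 0"
      using fx0 by (intro inner_zero_if_norm_minimal x0(2)) (simp add: C_def lin)
    then show ?thesis
      using pos by (simp add: inner_diff_right inner_commute field_simps)
  qed
  then show ?thesis by (rule that)
qed

text \<open>The element of minimal norm in the closure of \<open>y + M\<close> is orthogonal to \<open>M\<close>.\<close>
lemma subspace_dense_if_orthogonal_trivial:
  fixes M :: "'b::{real_inner, complete_space} set"
  assumes M: "subspace M" and orth: "\<And>w. (\<And>u. u \<in> M \<Longrightarrow> inner w u = 0) \<Longrightarrow> w = 0"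
    and e: "e > 0"
  shows "\<exists>u\<in>M. norm (y - u) < e"
proof -
  define A where "A = (\<lambda>u. y + u) ` M"
  have "convex A" "A \<noteq> {}"
    using convex_translation[OF subspace_imp_convex[OF M]] subspace_0[OF M] by (auto simp: A_def)
  then obtain w where w: "w \<in> closure A" "\<And>z. z \<in> closure A \<Longrightarrow> norm w \<le> norm z"
    using min_norm_in_closed_convex[of "closure A"] convex_closure by (metis closed_closure closure_eq_empty)
  have "inner w v = 0" if v: "v \<in> M" for v
  proof (rule inner_zero_if_norm_minimal, rule w(2))
    fix s
    have "(\<lambda>z. s *\<^sub>R v + z) ` A \<subseteq> A"
      unfolding A_def using subspace_add[OF M] subspace_scale[OF M v, of s]
      by (auto simp: image_iff add.left_commute)
    then have "(\<lambda>z. s *\<^sub>R v + z) ` closure A \<subseteq> closure A"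
      unfolding closure_translation[symmetric] by (rule closure_mono)
    then show "w + s *\<^sub>R v \<in> closure A"
      using w(1) by (auto simp: add.commute)
  qed
  then have "w = 0"
    by (rule orth)
  then have "\<exists>z\<in>A. dist z 0 < e"
    using w(1) e by (simp add: closure_approachable)
  then obtain u where u: "u \<in> M" "norm (y + u) < e"
    by (auto simp: A_def)
  then show ?thesis
    using subspace_neg[OF M u(1)] by (intro bexI[of _ "- u"]) auto
qed

text \<open>The adjoint is taken with respect to the real inner product, which is the real part of the
  complex one; for a complex-linear operator this is the usual adjoint, and it is complex-linear
  by \<open>bounded_clinear_adjoint\<close> below.\<close>
lemma inner_adjoint:
  fixes T :: "'b::{real_inner, complete_space} \<Rightarrow> 'c::real_inner"
  assumes "bounded_linear T"
  shows "inner (T x) y = inner x (adjoint T y)"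
proof -
  have "\<exists>w. \<forall>x. inner (T x) y = inner x w" for y
  proof -
    have "bounded_linear (\<lambda>x. inner (T x) y)"
      using bounded_linear_compose[OF bounded_linear_inner_left assms] .
    then show ?thesis
      by (rule riesz_representation) blast
  qed
  then have "\<exists>f'. \<forall>x y. inner (T x) y = inner x (f' y)"
    by metis
  then have "\<forall>x y. inner (T x) y = inner x (adjoint T y)"
    unfolding adjoint_def by (rule someI_ex)
  then show ?thesis by blast
qed

lemma norm_adjoint_le:
  fixes T :: "'b::{real_inner, complete_space} \<Rightarrow> 'c::real_inner"
  assumes T: "bounded_linear T" and B: "B \<ge> 0" "\<And>x. norm (T x) \<le> B * norm x"
  shows "norm (adjoint T y) \<le> B * norm y"
proof -
  have "(norm (adjoint T y))\<^sup>2 = inner (T (adjoint T y)) y"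
    by (simp add: power2_norm_eq_inner inner_adjoint[OF T])
  also have "\<dots> \<le> norm (T (adjoint T y)) * norm y"
    by (rule norm_cauchy_schwarz)
  also have "\<dots> \<le> (B * norm (adjoint T y)) * norm y"
    by (intro mult_right_mono B(2)) simp
  finally have "norm (adjoint T y) * norm (adjoint T y) \<le> norm (adjoint T y) * (B * norm y)"
    by (simp add: power2_eq_square mult_ac)
  then show ?thesis
    using B(1) by (cases "adjoint T y = 0") auto
qed

lemma bounded_clinear_adjoint:
  assumes "bounded_clinear T"
  shows "bounded_clinear (adjoint T)"
proof -
  have T: "bounded_linear T" and TC: "\<And>c x. T (c *\<^sub>C x) = c *\<^sub>C T x"
    using assms by (auto simp: bounded_clinear_def)
  note eq = inner_adjoint[OF T, symmetric]
  have "bounded_linear (adjoint T)"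
  proof (rule bounded_linear_intro)
    show "adjoint T (x + y) = adjoint T x + adjoint T y" for x y
      by (rule vector_eq_ldot[THEN iffD1]) (simp add: eq inner_add_right)
    show "adjoint T (c *\<^sub>R x) = c *\<^sub>R adjoint T x" for c x
      by (rule vector_eq_ldot[THEN iffD1]) (simp add: eq)
    show "norm (adjoint T x) \<le> norm x * onorm T" for x
      using norm_adjoint_le[OF T onorm_pos_le[OF T] onorm[OF T], of x] by (simp add: mult.commute)
  qed
  moreover have "adjoint T (c *\<^sub>C x) = c *\<^sub>C adjoint T x" for c x
  proof (rule vector_eq_ldot[THEN iffD1], rule allI)
    fix u
    have "inner u (adjoint T (c *\<^sub>C x)) = inner (T (cnj c *\<^sub>C u)) x"
      by (simp add: eq TC inner_scaleC_left)
    also have "\<dots> = inner u (c *\<^sub>C adjoint T x)"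
      unfolding inner_adjoint[OF T] by (simp add: inner_scaleC_left)
    finally show "inner u (adjoint T (c *\<^sub>C x)) = inner u (c *\<^sub>C adjoint T x)" .
  qed
  ultimately show ?thesis
    by (simp add: bounded_clinear_def)
qed

section \<open>The adjoint semigroup\<close>

context resolvent_bounded_semigroup
begin

lemma S_linear: "s \<ge> 0 \<Longrightarrow> bounded_linear (S s)"
  using S_clinear by (simp add: bounded_clinear_def)

lemma Q_linear: "Re z > \<omega> \<Longrightarrow> bounded_linear (Q z)"
  using Q_clinear by (simp add: bounded_clinear_def)

text \<open>If \<open>Q z x = 0\<close>, then \<open>Q z (e\<^bsup>-zs\<^esup> S s x)\<close> vanishes for all \<open>s\<close>, and so does its derivative \<open>- x\<close>
  at zero.\<close>
lemma Q_injective: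
  assumes z: "Re z > \<omega>" and "Q z x = 0"
  shows "x = 0"
proof -
  have "((\<lambda>s. Q z (exp (- z * of_real s) *\<^sub>C S s x)) has_vector_derivative
      - (exp (- z * of_real 0) *\<^sub>C S 0 x)) (at 0 within {0..1})"
    by (rule Q_orbit_has_derivative[OF z]) auto
  then have "((\<lambda>s::real. 0) has_vector_derivative - x) (at 0 within {0..1})"
    using assms(2) Q_clinear[OF z]
    by (rule_tac has_vector_derivative_transform[of 0 "{0..1}"])
      (auto simp: S_0 scaleC_one bounded_clinear_def Q_commute[OF z] linear_simps[OF S_linear])
  then show ?thesis
    using vector_derivative_unique_within_closed_interval[of 0 1 0 "\<lambda>s. 0" "- x" 0] by simp
qed

text \<open>The orthogonal complement of the range of an adjoint is the kernel of the operator.\<close>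
lemma adjoint_Q_range_dense:
  assumes z: "Re z > \<omega>" and e: "e > 0"
  shows "\<exists>u. norm (y - adjoint (Q z) u) < e"
proof -
  have lin: "linear (adjoint (Q z))"
    using bounded_clinear_adjoint[OF Q_clinear[OF z]]
    by (simp add: bounded_clinear_def bounded_linear.linear)
  have "w = 0" if "\<And>u. u \<in> range (adjoint (Q z)) \<Longrightarrow> inner w u = 0" for w
  proof (rule Q_injective[OF z])
    have "inner (Q z w) (Q z w) = 0"
      using that by (simp add: inner_adjoint[OF Q_linear[OF z]])
    then show "Q z w = 0" by simp
  qed
  then have "\<exists>u\<in>range (adjoint (Q z)). norm (y - u) < e"
    using linear_subspace_image[OF lin subspace_UNIV] e
    by (intro subspace_dense_if_orthogonal_trivial) auto
  then show ?thesis by blast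
qed

lemma adjoint_S_bound_interval:
  assumes "a \<ge> 0"
  shows "\<exists>B\<ge>1. \<forall>s\<in>{0..a}. \<forall>y. norm (adjoint (S s) y) \<le> B * norm y"
proof -
  obtain B where "B \<ge> 1" "\<And>s x. s \<in> {0..a} \<Longrightarrow> exp (0 * s) * norm (S s x) \<le> B * norm x"
    using S_bound_interval[OF assms, of 0] by blast
  then show ?thesis
    by (intro exI[of _ B]) (auto intro!: norm_adjoint_le S_linear)
qed

text \<open>Tested against \<open>x\<close>, the increment of \<open>e\<^bsup>-bs\<^esup> S\<^sup>* s Q\<^sup>* u\<close> is the inner product of \<open>u\<close> with an
  integral of \<open>e\<^bsup>-b\<sigma>\<^esup> S \<sigma> x\<close> over an interval, by the truncated Laplace transform. Hence it is
  bounded by a multiple of \<open>\<parallel>x\<parallel>\<close> times the length of that interval, and the adjoint orbit is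
  Lipschitz continuous after multiplication by \<open>e\<^bsup>-bs\<^esup>\<close>.\<close>
lemma adjoint_orbit_continuous_on_range:
  assumes b: "b > \<omega>" and a: "a \<ge> 0"
  shows "continuous_on {0..a} (\<lambda>s. adjoint (S s) (adjoint (Q (of_real b)) u))"
proof -
  have z: "Re (of_real b) > \<omega>"
    using assms by simp
  obtain B where B: "B \<ge> 1" "\<And>s x. s \<in> {0..a} \<Longrightarrow> exp (- b * s) * norm (S s x) \<le> B * norm x"
    using S_bound_interval[OF a, of "- b"] by blast
  define g where "g s = exp (- b * s) *\<^sub>R adjoint (S s) (adjoint (Q (of_real b)) u)" for s
  define G where "G x s = exp (- b * s) *\<^sub>R S s x" for x s
  have expC: "exp (- of_real b * of_real s) *\<^sub>C y = exp (- b * s) *\<^sub>R y" for s and y :: 'a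
    by (simp add: scaleR_scaleC flip: exp_of_real)
  have G_int: "G x integrable_on {c..d}" if "c \<ge> 0" for c d x
    unfolding G_def using that by (intro integrable_continuous_interval continuous_intros)
  have inner_g: "inner x (g s) = inner (Q (of_real b) x - integral {0..s} (G x)) u" if "s \<ge> 0" for x s
  proof -
    have "integral {0..s} (G x) = Q (of_real b) x - G (Q (of_real b) x) s"
      using integral_unique[OF Q_laplace[OF z that, of x]] unfolding expC G_def[abs_def] .
    moreover have "inner x (g s) = inner (G (Q (of_real b) x) s) u"
      unfolding g_def G_def inner_scaleR_right inner_scaleR_left
        inner_adjoint[OF S_linear[OF that], symmetric] inner_adjoint[OF Q_linear[OF z], symmetric]
        Q_commute[OF z that] by (rule refl)
    ultimately show ?thesis by simp
  qed
  have lip: "norm (g d - g c) \<le> B * norm u * (d - c)" if cd: "c \<in> {0..a}" "d \<in> {0..a}" "c \<le> d" for c d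
  proof -
    define w where "w = g d - g c"
    have "(norm w)\<^sup>2 = inner w (g d) - inner w (g c)"
      by (simp add: w_def power2_norm_eq_inner inner_diff_right)
    also have "\<dots> = - inner (integral {c..d} (G w)) u"
    proof -
      have "integral {0..d} (G w) = integral {0..c} (G w) + integral {c..d} (G w)"
        using cd by (intro Henstock_Kurzweil_Integration.integral_combine[symmetric] G_int) auto
      then show ?thesis
        using cd by (simp add: inner_g inner_diff_left inner_add_left)
    qed
    also have "\<dots> \<le> norm (integral {c..d} (G w)) * norm u"
      using norm_cauchy_schwarz[of "- integral {c..d} (G w)" u] by simp
    also have "norm (integral {c..d} (G w)) \<le> integral {c..d} (\<lambda>s. B * norm w)"
      using cd B(2) by (intro integral_norm_bound_integral G_int) (auto simp: G_def)
    also have "\<dots> = (d - c) * (B * norm w)"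
      using cd by simp
    finally have "norm w * norm w \<le> norm w * (B * norm u * (d - c))"
      by (simp add: power2_eq_square mult_ac mult_right_mono)
    moreover have "0 \<le> B * norm u * (d - c)"
      using B(1) cd by simp
    ultimately show ?thesis
      unfolding w_def[symmetric] by (cases "w = 0") auto
  qed
  have "(B * norm u)-lipschitz_on {0..a} g"
  proof (rule lipschitz_onI)
    fix c d assume "c \<in> {0..a}" "d \<in> {0..a}"
    then show "dist (g c) (g d) \<le> B * norm u * dist c d"
      using lip[of c d] lip[of d c]
      by (cases "c \<le> d") (auto simp: dist_norm norm_minus_commute)
  qed (use B in auto)
  then have "continuous_on {0..a} (\<lambda>s. exp (b * s) *\<^sub>R g s)"
    by (intro continuous_intros lipschitz_on_continuous_on)
  moreover have "exp (b * s) *\<^sub>R g s = adjoint (S s) (adjoint (Q (of_real b)) u)" for s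
    by (simp add: g_def flip: exp_add)
  ultimately show ?thesis by simp
qed

text \<open>Duality alone gives weak continuity. Continuity in norm holds on the dense range of
  \<open>Q\<^sup>*\<close> and extends to all \<open>y\<close> because the operators \<open>S\<^sup>* s\<close> are bounded uniformly on bounded
  intervals.\<close>
lemma adjoint_orbit_continuous: "continuous_on {0..} (\<lambda>s. adjoint (S s) y)"
proof -
  have "continuous_on {0..a} (\<lambda>s. adjoint (S s) y)" if a: "a \<ge> 0" for a
  proof -
    obtain B where B: "B \<ge> 1" "\<And>s y. s \<in> {0..a} \<Longrightarrow> norm (adjoint (S s) y) \<le> B * norm y"
      using adjoint_S_bound_interval[OF a] by blast
    define b where "b = \<omega> + 1"
    have b: "b > \<omega>"
      by (simp add: b_def)
    have "\<exists>u. norm (y - adjoint (Q (of_real b)) u) < inverse (real (Suc n))" for n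
      by (rule adjoint_Q_range_dense) (use b in auto)
    then obtain U where U: "\<And>n. norm (y - adjoint (Q (of_real b)) (U n)) < inverse (real (Suc n))"
      by metis
    have "uniform_limit {0..a} (\<lambda>n s. adjoint (S s) (adjoint (Q (of_real b)) (U n)))
        (\<lambda>s. adjoint (S s) y) sequentially"
    proof (rule uniform_limitI)
      fix e :: real assume e: "e > 0"
      obtain N where N: "inverse (real (Suc N)) < e / B"
        using reals_Archimedean[of "e / B"] e B(1) by auto
      have "dist (adjoint (S s) (adjoint (Q (of_real b)) (U n))) (adjoint (S s) y) < e"
        if n: "n \<ge> N" and s: "s \<in> {0..a}" for n s
      proof -
        have "bounded_linear (adjoint (S s))"
          using bounded_clinear_adjoint[OF S_clinear] s by (auto simp: bounded_clinear_def)
        then have "dist (adjoint (S s) (adjoint (Q (of_real b)) (U n))) (adjoint (S s) y)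
            = norm (adjoint (S s) (y - adjoint (Q (of_real b)) (U n)))"
          by (simp add: dist_norm norm_minus_commute linear_simps)
        also have "\<dots> \<le> B * norm (y - adjoint (Q (of_real b)) (U n))"
          by (rule B(2)[OF s])
        also have "\<dots> \<le> B * inverse (real (Suc n))"
          using U[of n] B(1) by (intro mult_left_mono) auto
        also have "\<dots> \<le> B * inverse (real (Suc N))"
          using B(1) n by (intro mult_left_mono le_imp_inverse_le) auto
        also have "\<dots> < e"
          using N B(1) by (simp add: field_simps)
        finally show ?thesis .
      qed
      then show "\<forall>\<^sub>F n in sequentially. \<forall>s\<in>{0..a}.
          dist (adjoint (S s) (adjoint (Q (of_real b)) (U n))) (adjoint (S s) y) < e"
        unfolding eventually_sequentially by blast
    qed
    then show ?thesis
      by (rule uniform_limit_theorem[rotated])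
        (auto intro!: always_eventually adjoint_orbit_continuous_on_range a b)
  qed
  note cont = this
  show ?thesis
    unfolding continuous_on_eq_continuous_within
  proof
    fix s :: real assume "s \<in> {0..}"
    then have "continuous (at s within {0..s + 1}) (\<lambda>s. adjoint (S s) y)"
      using cont[of "s + 1"] by (auto simp: continuous_on_eq_continuous_within)
    moreover have "at s within {0..s + 1} = at s within {0..}"
      by (rule at_within_nhd[of _ "{..<s + 1}"]) auto
    ultimately show "continuous (at s within {0..}) (\<lambda>s. adjoint (S s) y)"
      by simp
  qed
qed

text \<open>The conjugate in \<open>Q (cnj z)\<close> is due to the adjoint of multiplication by \<open>e\<^bsup>-zs\<^esup>\<close>.\<close>
lemma adjoint_semigroup:
  "resolvent_bounded_semigroup (\<lambda>s. adjoint (S s)) (\<lambda>z. adjoint (Q (cnj z))) \<omega> r m"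
proof
  fix s t :: real and x :: 'a and z :: complex
  have ext: "v = w" if "\<And>u. inner u v = inner u w" for v w :: 'a
    using that vector_eq_ldot by blast
  show "bounded_clinear (adjoint (S s))" if "s \<ge> 0"
    by (intro bounded_clinear_adjoint S_clinear that)
  show "adjoint (S 0) x = x"
    by (rule ext) (simp add: inner_adjoint[OF S_linear, symmetric] S_0)
  show "adjoint (S (s + t)) x = adjoint (S s) (adjoint (S t) x)" if "s \<ge> 0" "t \<ge> 0"
    using that S_add[of t s]
    by (intro ext) (simp add: inner_adjoint[OF S_linear, symmetric] add.commute)
  show "continuous_on {0..} (\<lambda>s. adjoint (S s) x)"
    by (rule adjoint_orbit_continuous)
  show "continuous_on {0..} m"
    by (rule m_continuous)
  show "m s \<ge> 0" if "s \<ge> 0"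
    by (rule m_nonneg[OF that])
  show "norm (adjoint (S s) x) \<le> m s * norm x" if "s \<ge> 0"
    by (intro norm_adjoint_le S_linear S_bound m_nonneg that)
  show "r > 0"
    by (rule r_pos)
  assume "Re z > \<omega>"
  then have z: "Re (cnj z) > \<omega>"
    by simp
  show "bounded_clinear (adjoint (Q (cnj z)))"
    by (intro bounded_clinear_adjoint Q_clinear z)
  have "norm (adjoint (Q (cnj z)) x) \<le> inverse r * norm x"
    using Q_bound[OF z] r_pos by (intro norm_adjoint_le Q_linear z) (simp_all add: field_simps)
  then show "r * norm (adjoint (Q (cnj z)) x) \<le> norm x"
    using r_pos by (simp add: field_simps)
  assume s: "s \<ge> 0"
  show commute: "adjoint (Q (cnj z)) (adjoint (S s) x) = adjoint (S s) (adjoint (Q (cnj z)) x)"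
    using s by (intro ext) (simp add: inner_adjoint[OF S_linear, symmetric]
        inner_adjoint[OF Q_linear[OF z], symmetric] Q_commute[OF z])
  define f where "f \<sigma> = exp (- z * of_real \<sigma>) *\<^sub>C adjoint (S \<sigma>) x" for \<sigma> :: real
  have "f integrable_on {0..s}"
    unfolding f_def
    by (intro integrable_continuous_interval continuous_intros
        continuous_on_subset[OF adjoint_orbit_continuous]) auto
  then have f: "(f has_integral integral {0..s} f) {0..s}"
    by (rule integrable_integral)
  have "integral {0..s} f =
      adjoint (Q (cnj z)) x - exp (- z * of_real s) *\<^sub>C adjoint (S s) (adjoint (Q (cnj z)) x)"
  proof (rule ext)
    fix u
    have cnj_exp: "cnj (exp (- cnj z * of_real \<sigma>)) = exp (- z * of_real \<sigma>)" for \<sigma>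
      by (simp add: exp_cnj)
    have inner_f: "((\<lambda>\<sigma>. inner u (f \<sigma>)) has_integral inner u (integral {0..s} f)) {0..s}"
      using has_integral_linear[OF f bounded_linear_inner_right] by (simp add: o_def)
    have inner_S: "((\<lambda>\<sigma>. inner (exp (- cnj z * of_real \<sigma>) *\<^sub>C S \<sigma> u) x) has_integral
        inner (Q (cnj z) u - exp (- cnj z * of_real s) *\<^sub>C S s (Q (cnj z) u)) x) {0..s}"
      using has_integral_linear[OF Q_laplace[OF z s] bounded_linear_inner_left]
      unfolding o_def .
    have move: "inner (exp (- cnj z * of_real \<sigma>) *\<^sub>C S \<sigma> u) x = inner u (f \<sigma>)"
      if "\<sigma> \<in> {0..s}" for \<sigma>
    proof -
      have "inner (exp (- cnj z * of_real \<sigma>) *\<^sub>C S \<sigma> u) x = inner u (adjoint (S \<sigma>) (exp (- z * of_real \<sigma>) *\<^sub>C x))"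
        using that unfolding inner_scaleC_left cnj_exp by (simp add: inner_adjoint[OF S_linear])
      then show ?thesis
        using bounded_clinear_adjoint[OF S_clinear, of \<sigma>] that by (simp add: f_def bounded_clinear_def)
    qed
    have "inner u (integral {0..s} f) =
        inner (Q (cnj z) u - exp (- cnj z * of_real s) *\<^sub>C S s (Q (cnj z) u)) x"
      by (rule has_integral_unique[OF inner_f has_integral_eq[OF move inner_S]])
    also have "\<dots> = inner (Q (cnj z) u) x - inner (Q (cnj z) (S s u)) (exp (- z * of_real s) *\<^sub>C x)"
      unfolding inner_diff_left inner_scaleC_left cnj_exp Q_commute[OF z s] ..
    also have "\<dots> = inner u (adjoint (Q (cnj z)) x
        - adjoint (S s) (adjoint (Q (cnj z)) (exp (- z * of_real s) *\<^sub>C x)))"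
      unfolding inner_adjoint[OF Q_linear[OF z]] inner_adjoint[OF S_linear[OF s]] inner_diff_right ..
    finally show "inner u (integral {0..s} f) = inner u (adjoint (Q (cnj z)) x
        - exp (- z * of_real s) *\<^sub>C adjoint (S s) (adjoint (Q (cnj z)) x))"
      using bounded_clinear_adjoint[OF S_clinear[OF s]] bounded_clinear_adjoint[OF Q_clinear[OF z]]
      by (simp add: bounded_clinear_def)
  qed
  then show "((\<lambda>\<sigma>. exp (- z * of_real \<sigma>) *\<^sub>C adjoint (S \<sigma>) x) has_integral
      adjoint (Q (cnj z)) x - exp (- z * of_real s) *\<^sub>C adjoint (S s) (adjoint (Q (cnj z)) x)) {0..s}"
    using f unfolding f_def by simp
qed

end

section \<open>Generator and resolvent of a strongly continuous semigroup\<close>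

context
  fixes S :: "real \<Rightarrow> 'a::complex_hilbert_space \<Rightarrow> 'a"
  assumes semigroup: "strongly_continuous_semigroup S"
begin

lemma semigroup_clinear: "s \<ge> 0 \<Longrightarrow> bounded_clinear (S s)"
  using semigroup by (simp add: strongly_continuous_semigroup_def)

lemma semigroup_linear: "s \<ge> 0 \<Longrightarrow> bounded_linear (S s)"
  using semigroup_clinear by (simp add: bounded_clinear_def)

lemma semigroup_add: "s \<ge> 0 \<Longrightarrow> t \<ge> 0 \<Longrightarrow> S (s + t) x = S s (S t x)"
  using semigroup by (simp add: strongly_continuous_semigroup_def)

lemma semigroup_continuous: "continuous_on {0..} (\<lambda>s. S s x)"
  using semigroup by (simp add: strongly_continuous_semigroup_def)

lemma generator_tendsto:
  assumes "x \<in> generator_domain S"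
  shows "((\<lambda>h. (S h x - x) /\<^sub>R h) \<longlongrightarrow> generator S x) (at_right 0)"
proof -
  obtain y where y: "((\<lambda>h. (S h x - x) /\<^sub>R h) \<longlongrightarrow> y) (at_right 0)"
    using assms by (auto simp: generator_domain_def)
  moreover have "generator S x = y"
    unfolding generator_def by (rule tendsto_Lim[OF _ y]) simp
  ultimately show ?thesis by simp
qed

lemma generator_commute:
  assumes x: "x \<in> generator_domain S" and s: "s \<ge> 0"
  shows "S s x \<in> generator_domain S" "generator S (S s x) = S s (generator S x)"
proof -
  have "((\<lambda>h. S s ((S h x - x) /\<^sub>R h)) \<longlongrightarrow> S s (generator S x)) (at_right 0)"
    by (rule bounded_linear.tendsto[OF semigroup_linear[OF s] generator_tendsto[OF x]])
  moreover have "\<forall>\<^sub>F h in at_right 0. S s ((S h x - x) /\<^sub>R h) = (S h (S s x) - S s x) /\<^sub>R h"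
    using eventually_at_right_less[of "0::real"]
  proof eventually_elim
    case (elim h)
    have "S s (S h x) = S h (S s x)"
      using semigroup_add[of s h x] semigroup_add[of h s x] s elim by (simp add: add.commute)
    then show ?case
      by (simp add: linear_simps[OF semigroup_linear[OF s]])
  qed
  ultimately have lim: "((\<lambda>h. (S h (S s x) - S s x) /\<^sub>R h) \<longlongrightarrow> S s (generator S x)) (at_right 0)"
    by (rule Lim_transform_eventually)
  then show "S s x \<in> generator_domain S"
    by (auto simp: generator_domain_def)
  show "generator S (S s x) = S s (generator S x)"
    unfolding generator_def[of S "S s x"] by (rule tendsto_Lim[OF _ lim]) simp
qed

text \<open>The generator is defined by right-hand difference quotients at zero. With \<open>l\<close> the smaller of the
  two times and \<open>h\<close> their distance, the semigroup law moves the quotient between them to zero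
  behind the bounded factor \<open>S l\<close>; this covers left-hand quotients as well.\<close>
lemma semigroup_has_derivative:
  assumes x: "x \<in> generator_domain S" and s: "s \<in> {0..a}"
    and B: "B > 0" "\<And>\<sigma> y. \<sigma> \<in> {0..a} \<Longrightarrow> norm (S \<sigma> y) \<le> B * norm y"
  shows "((\<lambda>s. S s x) has_vector_derivative S s (generator S x)) (at s within {0..a})"
  unfolding has_vector_derivative_def has_derivative_within_alt
proof (intro conjI allI impI)
  define y where "y = generator S x"
  show "bounded_linear (\<lambda>h. h *\<^sub>R S s (generator S x))"
    by (rule bounded_linear_scaleR_left)
  fix e :: real assume e: "e > 0"
  have "\<forall>\<^sub>F h in at_right 0. dist ((S h x - x) /\<^sub>R h) y < e / (2 * B)"
    unfolding y_def using generator_tendsto[OF x] e B(1) by (intro tendstoD) auto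
  then obtain d1 where d1: "d1 > 0"
    "\<And>h. 0 < h \<Longrightarrow> h < d1 \<Longrightarrow> dist ((S h x - x) /\<^sub>R h) y < e / (2 * B)"
    unfolding eventually_at_right_field by auto
  have start: "norm (S h x - x - h *\<^sub>R y) \<le> e / (2 * B) * h" if "0 < h" "h < d1" for h
  proof -
    have "S h x - x - h *\<^sub>R y = h *\<^sub>R ((S h x - x) /\<^sub>R h - y)"
      using that by (simp add: scaleR_diff_right)
    then have "norm (S h x - x - h *\<^sub>R y) = h * dist ((S h x - x) /\<^sub>R h) y"
      using that by (simp only: norm_scaleR dist_norm)
    also have "\<dots> \<le> h * (e / (2 * B))"
      using d1(2)[OF that] that by (intro mult_left_mono) auto
    finally show ?thesis by (simp only: mult.commute)
  qed
  have "continuous (at s within {0..a}) (\<lambda>s. S s y)"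
    using continuous_on_subset[OF semigroup_continuous, of "{0..a}"] s
    by (auto simp: continuous_on_eq_continuous_within)
  then obtain d2 where d2: "d2 > 0"
    "\<And>\<sigma>. \<sigma> \<in> {0..a} \<Longrightarrow> dist \<sigma> s < d2 \<Longrightarrow> dist (S \<sigma> y) (S s y) < e / 2"
    unfolding continuous_within_eps_delta using e by (metis half_gt_zero)
  have "norm (S \<sigma> x - S s x - (\<sigma> - s) *\<^sub>R S s y) \<le> e * norm (\<sigma> - s)"
    if \<sigma>: "\<sigma> \<in> {0..a}" and near: "norm (\<sigma> - s) < min d1 d2" for \<sigma>
  proof (cases "\<sigma> = s")
    case False
    define l h where "l = min \<sigma> s" and "h = \<bar>\<sigma> - s\<bar>"
    have l: "l \<in> {0..a}" and h: "0 < h" "h < d1"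
      using s \<sigma> near False by (auto simp: l_def h_def)
    have lin: "bounded_linear (S l)"
      using l by (intro semigroup_linear) auto
    have "norm (S (l + h) x - S l x - h *\<^sub>R S l y) = norm (S l (S h x - x - h *\<^sub>R y))"
      using semigroup_add[of l h x] l h by (simp add: linear_simps[OF lin])
    also have "\<dots> \<le> B * norm (S h x - x - h *\<^sub>R y)"
      by (rule B(2)[OF l])
    also have "\<dots> \<le> B * (e / (2 * B) * h)"
      using B(1) by (intro mult_left_mono start h) auto
    also have "\<dots> = e / 2 * h"
      using B(1) by simp
    finally have step: "norm (S (l + h) x - S l x - h *\<^sub>R S l y) \<le> e / 2 * h" .
    have shift: "norm (S l y - S s y) \<le> e / 2"
      using d2(2)[OF l] d2(1) near e by (auto simp: l_def dist_norm min_def split: if_splits)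
    have "norm (S \<sigma> x - S s x - (\<sigma> - s) *\<^sub>R S s y)
        \<le> norm (S (l + h) x - S l x - h *\<^sub>R S l y) + h * norm (S l y - S s y)"
    proof (cases "\<sigma> < s")
      case True
      then have lh: "l = \<sigma>" "l + h = s" "h = s - \<sigma>"
        by (auto simp: l_def h_def)
      have "S \<sigma> x - S s x - (\<sigma> - s) *\<^sub>R S s y =
          - ((S (l + h) x - S l x - h *\<^sub>R S l y) + h *\<^sub>R (S l y - S s y))"
        unfolding lh(2) unfolding lh(1) lh(3) by (simp add: algebra_simps)
      then have "norm (S \<sigma> x - S s x - (\<sigma> - s) *\<^sub>R S s y) =
          norm ((S (l + h) x - S l x - h *\<^sub>R S l y) + h *\<^sub>R (S l y - S s y))"
        by (simp only: norm_minus_cancel)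
      also have "\<dots> \<le> norm (S (l + h) x - S l x - h *\<^sub>R S l y) + norm (h *\<^sub>R (S l y - S s y))"
        by (rule norm_triangle_ineq)
      finally show ?thesis
        using h by simp
    next
      case False
      then have lh: "l = s" "l + h = \<sigma>" "h = \<sigma> - s"
        by (auto simp: l_def h_def)
      show ?thesis
        unfolding lh(2) unfolding lh(1) lh(3) using False by simp
    qed
    also have "\<dots> \<le> e / 2 * h + h * (e / 2)"
      using h by (intro add_mono step mult_left_mono shift) auto
    finally show ?thesis
      by (simp add: h_def mult.commute)
  qed simp
  then show "\<exists>d>0. \<forall>\<sigma>\<in>{0..a}. norm (\<sigma> - s) < d \<longrightarrow>
      norm (S \<sigma> x - S s x - (\<sigma> - s) *\<^sub>R S s (generator S x)) \<le> e * norm (\<sigma> - s)"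
    using d1(1) d2(1) unfolding y_def by (intro exI[of _ "min d1 d2"]) auto
qed

lemma resolvent_inverse:
  assumes z: "z \<in> resolvent_set (generator_domain S) (generator S)"
  defines "R \<equiv> resolvent (generator_domain S) (generator S) z"
  shows "R x \<in> generator_domain S" "z *\<^sub>C R x - generator S (R x) = x"
    "y \<in> generator_domain S \<Longrightarrow> R (z *\<^sub>C y - generator S y) = y"
proof -
  have bij: "bij_betw (\<lambda>x. z *\<^sub>C x - generator S x) (generator_domain S) UNIV"
    using z by (simp add: resolvent_set_def)
  then have img: "x \<in> (\<lambda>x. z *\<^sub>C x - generator S x) ` generator_domain S"
    by (simp add: bij_betw_def)
  show "R x \<in> generator_domain S"
    unfolding R_def resolvent_def by (rule inv_into_into[OF img])
  show "z *\<^sub>C R x - generator S (R x) = x"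
    unfolding R_def resolvent_def using f_inv_into_f[OF img] .
  show "R (z *\<^sub>C y - generator S y) = y" if "y \<in> generator_domain S"
    unfolding R_def resolvent_def using inv_into_f_f[OF bij_betw_imp_inj_on[OF bij] that] .
qed

lemma resolvent_commute:
  assumes z: "z \<in> resolvent_set (generator_domain S) (generator S)" and s: "s \<ge> 0"
  defines "R \<equiv> resolvent (generator_domain S) (generator S) z"
  shows "R (S s x) = S s (R x)"
proof -
  note inv = resolvent_inverse[OF z, folded R_def]
  have "z *\<^sub>C S s (R x) - generator S (S s (R x)) = S s (z *\<^sub>C R x - generator S (R x))"
    using semigroup_clinear[OF s] generator_commute(2)[OF inv(1) s]
    by (simp add: bounded_clinear_def linear_simps)
  also have "\<dots> = S s x"
    by (simp add: inv(2))
  finally show ?thesis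
    using inv(3)[OF generator_commute(1)[OF inv(1) s], of x] by simp
qed

text \<open>For \<open>y = R x\<close> in the domain of the generator, \<open>e\<^bsup>-z\<sigma>\<^esup> S \<sigma> y\<close> has the derivative
  \<open>- e\<^bsup>-z\<sigma>\<^esup> S \<sigma> ((z - A) y) = - e\<^bsup>-z\<sigma>\<^esup> S \<sigma> x\<close>.\<close>
lemma resolvent_laplace:
  assumes z: "z \<in> resolvent_set (generator_domain S) (generator S)" and s: "s \<ge> 0"
    and B: "B > 0" "\<And>\<sigma> y. \<sigma> \<in> {0..s} \<Longrightarrow> norm (S \<sigma> y) \<le> B * norm y"
  defines "R \<equiv> resolvent (generator_domain S) (generator S) z"
  shows "((\<lambda>\<sigma>. exp (- z * of_real \<sigma>) *\<^sub>C S \<sigma> x) has_integral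
        R x - exp (- z * of_real s) *\<^sub>C S s (R x)) {0..s}"
proof -
  note inv = resolvent_inverse[OF z, folded R_def]
  define E where "E \<sigma> = exp (- z * of_real \<sigma>)" for \<sigma> :: real
  have E: "(E has_vector_derivative - z * E \<sigma>) (at \<sigma> within {0..s})" for \<sigma>
  proof -
    have "((\<lambda>w. exp (- z * w)) has_field_derivative - z * exp (- z * of_real \<sigma>)) (at (of_real \<sigma>))"
      by (auto intro!: derivative_eq_intros)
    then show ?thesis
      unfolding E_def by (rule has_vector_derivative_real_field)
  qed
  have "((\<lambda>\<sigma>. E \<sigma> *\<^sub>C S \<sigma> (R x)) has_vector_derivative - (E \<sigma> *\<^sub>C S \<sigma> x)) (at \<sigma> within {0..s})"
    if \<sigma>: "\<sigma> \<in> {0..s}" for \<sigma>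
  proof -
    have "((\<lambda>\<sigma>. E \<sigma> *\<^sub>C S \<sigma> (R x)) has_vector_derivative
        E \<sigma> *\<^sub>C S \<sigma> (generator S (R x)) + (- z * E \<sigma>) *\<^sub>C S \<sigma> (R x)) (at \<sigma> within {0..s})"
      by (intro bounded_bilinear.has_vector_derivative[OF bounded_bilinear_scaleC] E
          semigroup_has_derivative[OF inv(1) \<sigma> B])
    moreover have "E \<sigma> *\<^sub>C S \<sigma> (generator S (R x)) + (- z * E \<sigma>) *\<^sub>C S \<sigma> (R x) = - (E \<sigma> *\<^sub>C S \<sigma> x)"
    proof -
      have "S \<sigma> x = z *\<^sub>C S \<sigma> (R x) - S \<sigma> (generator S (R x))"
        using semigroup_clinear[of \<sigma>] \<sigma> arg_cong[OF inv(2)[of x], of "S \<sigma>"]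
        by (simp add: bounded_clinear_def linear_simps)
      then show ?thesis
        by (simp add: bounded_bilinear.diff_right[OF bounded_bilinear_scaleC]
            bounded_bilinear.minus_left[OF bounded_bilinear_scaleC] scaleC_scaleC mult.commute)
    qed
    ultimately show ?thesis by simp
  qed
  then have "((\<lambda>\<sigma>. - (E \<sigma> *\<^sub>C S \<sigma> x)) has_integral E s *\<^sub>C S s (R x) - E 0 *\<^sub>C S 0 (R x)) {0..s}"
    by (intro fundamental_theorem_of_calculus s)
  from has_integral_neg[OF this] show ?thesis
    using semigroup by (simp add: E_def scaleC_one strongly_continuous_semigroup_def)
qed

lemma generator_resolvent_bounded_semigroup:
  assumes half_plane: "{z. Re z \<ge> \<omega>} \<subseteq> resolvent_set (generator_domain S) (generator S)"
    and bdd: "\<exists>C. \<forall>z. Re z \<ge> \<omega> \<longrightarrow> onorm (resolvent (generator_domain S) (generator S) z) \<le> C"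
    and r: "r > 0"
    and sup: "1 / r = (SUP z\<in>{z. Re z > \<omega>}. onorm (resolvent (generator_domain S) (generator S) z))"
    and m: "continuous_on {0..} m" "\<And>s. s \<ge> 0 \<Longrightarrow> m s > 0" "\<And>s. s \<ge> 0 \<Longrightarrow> onorm (S s) \<le> m s"
  shows "resolvent_bounded_semigroup S (resolvent (generator_domain S) (generator S)) \<omega> r m"
proof
  fix s t :: real and x :: 'a and z :: complex
  have S_m: "norm (S \<sigma> y) \<le> m \<sigma> * norm y" if "\<sigma> \<ge> 0" for \<sigma> y
    using onorm[OF semigroup_linear[OF that], of y] m(3)[OF that]
    by (meson mult_right_mono norm_ge_zero order_trans)
  show "bounded_clinear (S s)" if "s \<ge> 0"
    by (rule semigroup_clinear[OF that])
  show "S 0 x = x"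
    using semigroup by (simp add: strongly_continuous_semigroup_def)
  show "S (s + t) x = S s (S t x)" if "s \<ge> 0" "t \<ge> 0"
    by (rule semigroup_add[OF that])
  show "continuous_on {0..} (\<lambda>s. S s x)"
    by (rule semigroup_continuous)
  show "continuous_on {0..} m"
    by (rule m(1))
  show "m s \<ge> 0" if "s \<ge> 0"
    using m(2)[OF that] by simp
  show "norm (S s x) \<le> m s * norm x" if "s \<ge> 0"
    by (rule S_m[OF that])
  show "r > 0"
    by (rule r)
  define R where "R = resolvent (generator_domain S) (generator S)"
  assume z: "Re z > \<omega>"
  then have z': "z \<in> resolvent_set (generator_domain S) (generator S)"
    using half_plane by auto
  then show R: "bounded_clinear (R z)"
    by (simp add: resolvent_set_def R_def)
  have "onorm (R z) \<le> 1 / r"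
    unfolding sup R_def
  proof (rule cSUP_upper)
    show "bdd_above ((\<lambda>z. onorm (resolvent (generator_domain S) (generator S) z)) ` {z. Re z > \<omega>})"
      using bdd by (auto simp: bdd_above_def intro: less_imp_le)
  qed (use z in simp)
  then have "norm (R z x) \<le> 1 / r * norm x"
    using onorm[of "R z" x] R by (meson bounded_clinear_def mult_right_mono norm_ge_zero order_trans)
  then show "r * norm (R z x) \<le> norm x"
    using r by (simp add: field_simps)
  assume s: "s \<ge> 0"
  show "R z (S s x) = S s (R z x)"
    unfolding R_def by (rule resolvent_commute[OF z' s])
  obtain B where B: "B > 0" "\<And>\<sigma>. \<sigma> \<in> {0..s} \<Longrightarrow> norm (m \<sigma>) \<le> B"
    using compact_imp_bounded[OF compact_continuous_image[OF continuous_on_subset[OF m(1)] compact_Icc], of 0 s]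
    unfolding bounded_pos by auto
  have "norm (S \<sigma> y) \<le> B * norm y" if "\<sigma> \<in> {0..s}" for \<sigma> y
  proof -
    have "norm (S \<sigma> y) \<le> m \<sigma> * norm y"
      using that by (intro S_m) simp
    also have "\<dots> \<le> B * norm y"
      using B(2)[OF that] by (intro mult_right_mono) auto
    finally show ?thesis .
  qed
  then show "((\<lambda>\<sigma>. exp (- z * of_real \<sigma>) *\<^sub>C S \<sigma> x) has_integral
      R z x - exp (- z * of_real s) *\<^sub>C S s (R z x)) {0..s}"
    unfolding R_def by (rule resolvent_laplace[OF z' s B(1)])
qed

end

section \<open>Weighted norms and the bound for the semigroup\<close>

text \<open>The Cauchy-Schwarz inequality, obtained by integrating the arithmetic-geometric mean inequality.\<close>
lemma integral_mult_le_if_square_integrals_le: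
  fixes f g :: "real \<Rightarrow> real"
  assumes cont: "continuous_on {a..b} f" "continuous_on {a..b} g"
    and A: "A \<ge> 0" "integral {a..b} (\<lambda>s. (f s)\<^sup>2) \<le> A\<^sup>2"
    and B: "B \<ge> 0" "integral {a..b} (\<lambda>s. (g s)\<^sup>2) \<le> B\<^sup>2"
  shows "integral {a..b} (\<lambda>s. f s * g s) \<le> A * B"
proof -
  have int: "(\<lambda>s. f s * g s) integrable_on {a..b}" "(\<lambda>s. (f s)\<^sup>2) integrable_on {a..b}"
    "(\<lambda>s. (g s)\<^sup>2) integrable_on {a..b}"
    by (intro integrable_continuous_interval continuous_intros cont)+
  \<comment> \<open>The summand \<open>e\<close> keeps the scaling factor \<open>c\<close> defined when \<open>A\<close> or \<open>B\<close> vanishes.\<close>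
  have le: "integral {a..b} (\<lambda>s. f s * g s) \<le> (A + e) * (B + e)" if e: "e > 0" for e
  proof -
    define c where "c = (B + e) / (A + e)"
    have c: "c > 0"
      using A(1) B(1) e by (simp add: c_def)
    have "f s * g s \<le> c / 2 * (f s)\<^sup>2 + inverse c / 2 * (g s)\<^sup>2" for s
    proof -
      have "0 \<le> (c * f s - g s)\<^sup>2 * (inverse c / 2)"
        using c by simp
      also have "\<dots> = c / 2 * (f s)\<^sup>2 + inverse c / 2 * (g s)\<^sup>2 - f s * g s"
        using c by (simp add: power2_eq_square field_simps)
      finally show ?thesis by simp
    qed
    then have "integral {a..b} (\<lambda>s. f s * g s)
        \<le> integral {a..b} (\<lambda>s. c / 2 * (f s)\<^sup>2 + inverse c / 2 * (g s)\<^sup>2)"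
      by (intro integral_le integrable_continuous_interval continuous_intros cont)
    also have "\<dots> = c / 2 * integral {a..b} (\<lambda>s. (f s)\<^sup>2) + inverse c / 2 * integral {a..b} (\<lambda>s. (g s)\<^sup>2)"
      by (subst Henstock_Kurzweil_Integration.integral_add)
        (auto intro!: integrable_continuous_interval continuous_intros cont)
    also have "\<dots> \<le> c / 2 * (A + e)\<^sup>2 + inverse c / 2 * (B + e)\<^sup>2"
    proof -
      have "A\<^sup>2 \<le> (A + e)\<^sup>2" "B\<^sup>2 \<le> (B + e)\<^sup>2"
        using A(1) B(1) e by (auto intro!: power_mono)
      then show ?thesis
        using c A(2) B(2) by (intro add_mono mult_left_mono) auto
    qed
    also have "\<dots> = (A + e) * (B + e)"
    proof -
      have "q / p / 2 * p\<^sup>2 + inverse (q / p) / 2 * q\<^sup>2 = p * q" if "p > 0" "q > 0" for p q :: real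
        using that by (simp add: power2_eq_square field_simps)
      from this[of "A + e" "B + e"] show ?thesis
        using A(1) B(1) e unfolding c_def by simp
    qed
    finally show ?thesis .
  qed
  have "((\<lambda>e. (A + e) * (B + e)) \<longlongrightarrow> (A + 0) * (B + 0)) (at_right 0)"
    by (intro tendsto_intros)
  moreover have "\<forall>\<^sub>F e in at_right 0. integral {a..b} (\<lambda>s. f s * g s) \<le> (A + e) * (B + e)"
    using eventually_at_right_less[of "0::real"] by eventually_elim (rule le)
  ultimately have "integral {a..b} (\<lambda>s. f s * g s) \<le> (A + 0) * (B + 0)"
    by (rule tendsto_lowerbound) simp
  then show ?thesis by simp
qed

lemma integral_reflect_interval:
  fixes f :: "real \<Rightarrow> real"
  shows "integral {0..t} (\<lambda>s. f (t - s)) = integral {0..t} f"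
proof -
  have "integral {0..t} (\<lambda>s. f (t - s)) = integral {- t..0} (\<lambda>s. f (s + t))"
    using Henstock_Kurzweil_Integration.integral_reflect_real[of 0 "- t" "\<lambda>s. f (s + t)"] by (simp add: add.commute)
  also have "\<dots> = integral {0..t} f"
    using integral_shift_real_ivl[of 0 t t f] by simp
  finally show ?thesis .
qed

lemma set_integral_eq_integral_continuous:
  fixes f :: "real \<Rightarrow> real"
  assumes "continuous_on {a..b} f"
  shows "(LINT s:{a..b}|lborel. f s) = integral {a..b} f"
    and "(LINT s:{a..<b}|lborel. f s) = integral {a..b} f"
proof -
  have int: "set_integrable lborel {a..b} f"
    by (rule borel_integrable_atLeastAtMost'[OF assms])
  then show "(LINT s:{a..b}|lborel. f s) = integral {a..b} f"
    by (rule set_borel_integral_eq_integral)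
  have "set_integrable lborel {a..<b} f"
    by (rule set_integrable_subset[OF int]) auto
  then have "(LINT s:{a..<b}|lborel. f s) = integral {a..<b} f"
    by (rule set_borel_integral_eq_integral)
  also have "\<dots> = integral {a..b} f"
    by (rule integral_spike_set; rule negligible_subset[of "{b}"]) auto
  finally show "(LINT s:{a..<b}|lborel. f s) = integral {a..b} f" .
qed

lemma weighted_L2_norm_nonneg: "weighted_L2_norm \<omega> t f \<ge> 0"
  by (simp add: weighted_L2_norm_def set_lebesgue_integral_def)

lemma weighted_L2_norm_square:
  assumes "continuous_on {0..t} f"
  shows "(weighted_L2_norm \<omega> t f)\<^sup>2 = integral {0..t} (\<lambda>s. exp (- 2 * \<omega> * s) * (f s)\<^sup>2)"
proof -
  have cont: "continuous_on {0..t} (\<lambda>s. exp (- 2 * \<omega> * s) * (f s)\<^sup>2)"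
    by (intro continuous_intros assms)
  have "integral {0..t} (\<lambda>s. exp (- 2 * \<omega> * s) * (f s)\<^sup>2) \<ge> 0"
    by (intro integral_nonneg integrable_continuous_interval cont) auto
  then show ?thesis
    unfolding weighted_L2_norm_def power2_abs set_integral_eq_integral_continuous(2)[OF cont]
    by (rule real_sqrt_pow2)
qed

lemma signed_part_nonneg: "signed_part \<epsilon> x \<ge> 0"
  by (cases \<epsilon>) auto

lemma continuous_on_signed_part [continuous_intros]:
  fixes A :: "real set"
  shows "continuous_on A f \<Longrightarrow> continuous_on A (\<lambda>s. signed_part \<epsilon> (f s))"
  by (cases \<epsilon>) (auto intro!: continuous_on_max continuous_on_minus continuous_on_const)

lemma signed_part_diff: "x = signed_part Plus x - signed_part Minus x"
  by auto

context resolvent_bounded_semigroup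
begin

text \<open>The weighted estimate says that the integral with the positive part of the weight is at most the
  integral with its negative part. Hence for either sign the integral is bounded by the latter,
  and there the orbit is replaced by its bound \<open>m s \<parallel>x\<parallel>\<close>.\<close>
lemma signed_weight_estimate:
  fixes \<epsilon> :: sign
  assumes t: "0 < t"
    and \<Phi>: "\<And>s. s \<in> {0..t} \<Longrightarrow> (\<Phi> has_real_derivative \<Phi>' s) (at s within {0..t})"
    and \<Phi>': "continuous_on {0..t} \<Phi>'" and \<Phi>0: "\<Phi> 0 = 0"
  shows "integral {0..t} (\<lambda>s. (sqrt (signed_part \<epsilon> (r\<^sup>2 * (\<Phi> s)\<^sup>2 - (\<Phi>' s)\<^sup>2))
      * (exp (- \<omega> * s) * norm (S s x)))\<^sup>2)
    \<le> (weighted_L2_norm \<omega> t (\<lambda>s. sqrt (signed_part Minus (r\<^sup>2 * (\<Phi> s)\<^sup>2 - (\<Phi>' s)\<^sup>2)) * m s) * norm x)\<^sup>2"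
proof -
  define w where "w s = r\<^sup>2 * (\<Phi> s)\<^sup>2 - (\<Phi>' s)\<^sup>2" for s
  define W where "W s = exp (- 2 * \<omega> * s) * (norm (S s x))\<^sup>2" for s
  have \<Phi>_cont: "continuous_on {0..t} \<Phi>"
    using \<Phi> by (intro DERIV_continuous_on) auto
  have w: "continuous_on {0..t} w"
    unfolding w_def by (intro continuous_intros \<Phi>_cont \<Phi>')
  have W: "continuous_on {0..t} W"
    unfolding W_def by (intro continuous_intros) auto
  have m: "continuous_on {0..t} m"
    by (rule continuous_on_subset[OF m_continuous]) auto
  have int: "(\<lambda>s. signed_part \<delta> (w s) * W s) integrable_on {0..t}" for \<delta>
    by (intro integrable_continuous_interval continuous_intros w W)
  have exp2: "exp (- 2 * \<omega> * s) = (exp (- \<omega> * s))\<^sup>2" for s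
    by (simp flip: exp_double)
  have "integral {0..t} (\<lambda>s. w s * W s) \<le> 0"
    unfolding w_def W_def by (intro weight_estimate t \<Phi> \<Phi>' \<Phi>0)
  also have "(\<lambda>s. w s * W s) = (\<lambda>s. signed_part Plus (w s) * W s - signed_part Minus (w s) * W s)"
    by (subst signed_part_diff) (simp only: left_diff_distrib)
  also have "integral {0..t} \<dots> = integral {0..t} (\<lambda>s. signed_part Plus (w s) * W s)
      - integral {0..t} (\<lambda>s. signed_part Minus (w s) * W s)"
    by (intro Henstock_Kurzweil_Integration.integral_diff int)
  finally have sign: "integral {0..t} (\<lambda>s. signed_part \<epsilon> (w s) * W s)
      \<le> integral {0..t} (\<lambda>s. signed_part Minus (w s) * W s)"
    by (cases \<epsilon>) auto
  have "integral {0..t} (\<lambda>s. (sqrt (signed_part \<epsilon> (w s)) * (exp (- \<omega> * s) * norm (S s x)))\<^sup>2)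
      = integral {0..t} (\<lambda>s. signed_part \<epsilon> (w s) * W s)"
    unfolding W_def exp2 by (simp only: power_mult_distrib real_sqrt_pow2[OF signed_part_nonneg])
  also note sign
  also have "integral {0..t} (\<lambda>s. signed_part Minus (w s) * W s)
      \<le> integral {0..t} (\<lambda>s. exp (- 2 * \<omega> * s) * (sqrt (signed_part Minus (w s)) * m s)\<^sup>2 * (norm x)\<^sup>2)"
  proof (intro integral_le int)
    show "(\<lambda>s. exp (- 2 * \<omega> * s) * (sqrt (signed_part Minus (w s)) * m s)\<^sup>2 * (norm x)\<^sup>2) integrable_on {0..t}"
      by (intro integrable_continuous_interval continuous_intros w m)
    fix s assume s: "s \<in> {0..t}"
    have "W s \<le> exp (- 2 * \<omega> * s) * (m s * norm x)\<^sup>2"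
      unfolding W_def using s by (intro mult_left_mono power_mono S_bound) auto
    then have "signed_part Minus (w s) * W s \<le> signed_part Minus (w s) * (exp (- 2 * \<omega> * s) * (m s * norm x)\<^sup>2)"
      by (rule mult_left_mono[OF _ signed_part_nonneg])
    also have "\<dots> = exp (- 2 * \<omega> * s) * (sqrt (signed_part Minus (w s)) * m s)\<^sup>2 * (norm x)\<^sup>2"
      by (simp only: power_mult_distrib real_sqrt_pow2[OF signed_part_nonneg] mult_ac)
    finally show "signed_part Minus (w s) * W s
        \<le> exp (- 2 * \<omega> * s) * (sqrt (signed_part Minus (w s)) * m s)\<^sup>2 * (norm x)\<^sup>2" .
  qed
  also have "\<dots> = (weighted_L2_norm \<omega> t (\<lambda>s. sqrt (signed_part Minus (w s)) * m s) * norm x)\<^sup>2"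
    by (subst power_mult_distrib, subst weighted_L2_norm_square)
      (auto intro!: continuous_intros w m)
  finally show ?thesis
    unfolding w_def .
qed

end

theorem theorem1p6:
  fixes S :: "real \<Rightarrow> 'a::complex_hilbert_space \<Rightarrow> 'a"
    and \<omega> r t :: real
    and m \<Phi> \<Phi>' \<Psi> \<Psi>' :: "real \<Rightarrow> real"
    and \<epsilon>\<^sub>1 \<epsilon>\<^sub>2 :: sign
  assumes "strongly_continuous_semigroup S"
    and "{z. Re z \<ge> \<omega>} \<subseteq> resolvent_set (generator_domain S) (generator S)"
    and "\<exists>C. \<forall>z. Re z \<ge> \<omega> \<longrightarrow> onorm (resolvent (generator_domain S) (generator S) z) \<le> C"
    and "r > 0"
    and "1 / r = (SUP z\<in>{z. Re z > \<omega>}. onorm (resolvent (generator_domain S) (generator S) z))"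
    and "continuous_on {0..} m"
    and "\<And>s. s \<ge> 0 \<Longrightarrow> m s > 0"
    and "\<And>s. s \<ge> 0 \<Longrightarrow> onorm (S s) \<le> m s"
    and "\<And>s. s \<ge> 0 \<Longrightarrow> (\<Phi> has_real_derivative \<Phi>' s) (at s within {0..})"
    and "continuous_on {0..} \<Phi>'"
    and "\<And>s. s \<ge> 0 \<Longrightarrow> (\<Psi> has_real_derivative \<Psi>' s) (at s within {0..})"
    and "continuous_on {0..} \<Psi>'"
    and "\<Phi> 0 = 0" and "\<Psi> 0 = 0"
    and "\<And>s. s > 0 \<Longrightarrow> \<Phi> s > 0" and "\<And>s. s > 0 \<Longrightarrow> \<Psi> s > 0"
    and "t > 0"
  shows "ereal (onorm (S t)) \<le>
    quotient_or_infinity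
      (exp (\<omega> * t)
        * weighted_L2_norm \<omega> t (\<lambda>s. sqrt (signed_part Minus (r\<^sup>2 * (\<Phi> s)\<^sup>2 - (\<Phi>' s)\<^sup>2)) * m s)
        * weighted_L2_norm \<omega> t (\<lambda>s. sqrt (signed_part Minus (r\<^sup>2 * (\<Psi> s)\<^sup>2 - (\<Psi>' s)\<^sup>2)) * m s))
      (LINT s:{0..t}|lborel.
          sqrt (signed_part \<epsilon>\<^sub>1 (r\<^sup>2 * (\<Phi> s)\<^sup>2 - (\<Phi>' s)\<^sup>2))
        * sqrt (signed_part \<epsilon>\<^sub>2 (r\<^sup>2 * (\<Psi> (t - s))\<^sup>2 - (\<Psi>' (t - s))\<^sup>2)))"
proof -
  interpret forward: resolvent_bounded_semigroup S "resolvent (generator_domain S) (generator S)" \<omega> r m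
    by (rule generator_resolvent_bounded_semigroup) (use assms in auto)
  interpret backward: resolvent_bounded_semigroup "\<lambda>s. adjoint (S s)"
    "\<lambda>z. adjoint (resolvent (generator_domain S) (generator S) (cnj z))" \<omega> r m
    by (rule forward.adjoint_semigroup)
  have \<Phi>: "(\<Phi> has_real_derivative \<Phi>' s) (at s within {0..t})" if "s \<in> {0..t}" for s
    using that by (intro DERIV_subset[OF assms(9)]) auto
  have \<Psi>: "(\<Psi> has_real_derivative \<Psi>' s) (at s within {0..t})" if "s \<in> {0..t}" for s
    using that by (intro DERIV_subset[OF assms(11)]) auto
  have \<Phi>': "continuous_on {0..t} \<Phi>'" and \<Psi>': "continuous_on {0..t} \<Psi>'"
    using assms(10,12) by (auto elim: continuous_on_subset)
  define N1 where "N1 = weighted_L2_norm \<omega> t (\<lambda>s. sqrt (signed_part Minus (r\<^sup>2 * (\<Phi> s)\<^sup>2 - (\<Phi>' s)\<^sup>2)) * m s)"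
  define N2 where "N2 = weighted_L2_norm \<omega> t (\<lambda>s. sqrt (signed_part Minus (r\<^sup>2 * (\<Psi> s)\<^sup>2 - (\<Psi>' s)\<^sup>2)) * m s)"
  have N: "N1 \<ge> 0" "N2 \<ge> 0"
    by (simp_all add: N1_def N2_def weighted_L2_norm_nonneg)
  define \<alpha> where "\<alpha> s = sqrt (signed_part \<epsilon>\<^sub>1 (r\<^sup>2 * (\<Phi> s)\<^sup>2 - (\<Phi>' s)\<^sup>2))" for s
  define \<beta> where "\<beta> s = sqrt (signed_part \<epsilon>\<^sub>2 (r\<^sup>2 * (\<Psi> s)\<^sup>2 - (\<Psi>' s)\<^sup>2))" for s
  define I where "I = integral {0..t} (\<lambda>s. \<alpha> s * \<beta> (t - s))"
  have \<Phi>_cont: "continuous_on {0..t} \<Phi>" and \<Psi>_cont: "continuous_on {0..t} \<Psi>"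
    by (rule DERIV_continuous_on[OF \<Phi>], assumption) (rule DERIV_continuous_on[OF \<Psi>])
  have \<alpha>: "continuous_on {0..t} \<alpha>" and \<beta>: "continuous_on {0..t} \<beta>"
    unfolding \<alpha>_def \<beta>_def by (intro continuous_intros \<Phi>_cont \<Phi>' \<Psi>_cont \<Psi>')+
  have nonneg: "\<alpha> s \<ge> 0" "\<beta> s \<ge> 0" for s
    by (simp_all add: \<alpha>_def \<beta>_def signed_part_nonneg)
  have reflect: "continuous_on {0..t} (\<lambda>s. f (t - s))" if "continuous_on {0..t} f" for f :: "real \<Rightarrow> real"
    by (rule continuous_on_compose2[OF that]) (auto intro!: continuous_on_diff continuous_on_const continuous_on_id)
  have weights: "continuous_on {0..t} (\<lambda>s. \<alpha> s * \<beta> (t - s))"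
    by (intro continuous_on_mult \<alpha> reflect[OF \<beta>])
  \<comment> \<open>The integrands are continuous, so the Lebesgue and the Henstock-Kurzweil integral agree.\<close>
  have denominator: "(LINT s:{0..t}|lborel. \<alpha> s * \<beta> (t - s)) = I"
    unfolding I_def by (rule set_integral_eq_integral_continuous(1)[OF weights])
  have "I \<ge> 0"
    unfolding I_def by (intro integral_nonneg integrable_continuous_interval weights) (simp add: nonneg)
  \<comment> \<open>\<open>f\<close> and \<open>g\<close> are the weighted orbits of \<open>x\<close> under the semigroup and of \<open>S t x\<close> under its
    adjoint; the product \<open>f s * g (t - s)\<close> dominates the left-hand side for each \<open>s\<close>.\<close>
  have key: "exp (- \<omega> * t) * (norm (S t x))\<^sup>2 * I \<le> (N1 * norm x) * (N2 * norm (S t x))" for x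
  proof -
    define y where "y = S t x"
    define f where "f s = \<alpha> s * (exp (- \<omega> * s) * norm (S s x))" for s
    define g where "g s = \<beta> s * (exp (- \<omega> * s) * norm (adjoint (S s) y))" for s
    have f: "continuous_on {0..t} f"
      unfolding f_def by (intro continuous_intros \<alpha> forward.S_continuous_interval) simp
    have g: "continuous_on {0..t} g"
      unfolding g_def by (intro continuous_intros \<beta> backward.S_continuous_interval) simp
    have f2: "integral {0..t} (\<lambda>s. (f s)\<^sup>2) \<le> (N1 * norm x)\<^sup>2"
      unfolding f_def \<alpha>_def N1_def by (intro forward.signed_weight_estimate \<Phi> \<Phi>' assms)
    have "integral {0..t} (\<lambda>s. (g s)\<^sup>2) \<le> (N2 * norm y)\<^sup>2"
      unfolding g_def \<beta>_def N2_def by (intro backward.signed_weight_estimate \<Psi> \<Psi>' assms)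
    then have g2: "integral {0..t} (\<lambda>s. (g (t - s))\<^sup>2) \<le> (N2 * norm y)\<^sup>2"
      using integral_reflect_interval[of t "\<lambda>s. (g s)\<^sup>2"] by simp
    have "exp (- \<omega> * t) * (norm y)\<^sup>2 * I = integral {0..t} (\<lambda>s. exp (- \<omega> * t) * (norm y)\<^sup>2 * (\<alpha> s * \<beta> (t - s)))"
      by (simp add: I_def)
    also have "\<dots> \<le> integral {0..t} (\<lambda>s. f s * g (t - s))"
    proof (rule integral_le)
      show "(\<lambda>s. exp (- \<omega> * t) * (norm y)\<^sup>2 * (\<alpha> s * \<beta> (t - s))) integrable_on {0..t}"
        by (intro integrable_continuous_interval continuous_on_mult continuous_on_const \<alpha> reflect[OF \<beta>])
      show "(\<lambda>s. f s * g (t - s)) integrable_on {0..t}"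
        by (intro integrable_continuous_interval continuous_on_mult f reflect[OF g])
      fix s assume s: "s \<in> {0..t}"
      have "(norm y)\<^sup>2 = inner (S (t - s) (S s x)) y"
        using forward.S_add[of "t - s" s x] s by (simp add: y_def power2_norm_eq_inner)
      also have "\<dots> = inner (S s x) (adjoint (S (t - s)) y)"
        using s by (intro inner_adjoint forward.S_linear) simp
      also have "\<dots> \<le> norm (S s x) * norm (adjoint (S (t - s)) y)"
        by (rule norm_cauchy_schwarz)
      finally have le: "exp (- \<omega> * t) * (norm y)\<^sup>2 * (\<alpha> s * \<beta> (t - s))
          \<le> exp (- \<omega> * t) * (norm (S s x) * norm (adjoint (S (t - s)) y)) * (\<alpha> s * \<beta> (t - s))"
        by (intro mult_right_mono mult_left_mono) (auto simp: nonneg)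
      have split: "exp (- \<omega> * t) = exp (- \<omega> * s) * exp (- \<omega> * (t - s))"
        unfolding exp_add[symmetric] by (simp add: algebra_simps)
      show "exp (- \<omega> * t) * (norm y)\<^sup>2 * (\<alpha> s * \<beta> (t - s)) \<le> f s * g (t - s)"
        using le unfolding f_def g_def split by (simp only: mult_ac)
    qed
    also have "\<dots> \<le> (N1 * norm x) * (N2 * norm y)"
      using N by (intro integral_mult_le_if_square_integrals_le f reflect[OF g] f2 g2) auto
    finally show ?thesis
      unfolding y_def .
  qed
  show ?thesis
    unfolding \<alpha>_def[symmetric] \<beta>_def[symmetric] N1_def[symmetric] N2_def[symmetric] denominator
  proof (cases "I = 0")
    case False
    then have I: "I > 0"
      using \<open>I \<ge> 0\<close> by simp
    have "norm (S t x) \<le> exp (\<omega> * t) * N1 * N2 / I * norm x" for x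
    proof (cases "S t x = 0")
      case False
      have "norm (S t x) * (exp (- \<omega> * t) * norm (S t x) * I) \<le> norm (S t x) * (N1 * N2 * norm x)"
        using key[of x] by (simp only: power2_eq_square mult_ac)
      then have "exp (- \<omega> * t) * norm (S t x) * I \<le> N1 * N2 * norm x"
        using False by simp
      then have "exp (\<omega> * t) * (exp (- \<omega> * t) * norm (S t x) * I) \<le> exp (\<omega> * t) * (N1 * N2 * norm x)"
        by (intro mult_left_mono) auto
      moreover have "exp (\<omega> * t) * (exp (- \<omega> * t) * norm (S t x) * I) = norm (S t x) * I"
        by (simp flip: mult.assoc exp_add)
      ultimately have "norm (S t x) * I \<le> exp (\<omega> * t) * (N1 * N2 * norm x)"
        by (simp only:)
      then have "norm (S t x) \<le> exp (\<omega> * t) * (N1 * N2 * norm x) / I"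
        using I by (simp add: pos_le_divide_eq)
      then show ?thesis
        by (simp add: mult.assoc)
    qed (use N I in simp)
    then have "onorm (S t) \<le> exp (\<omega> * t) * N1 * N2 / I"
      using N I by (intro onorm_bound) auto
    then show "ereal (onorm (S t)) \<le> quotient_or_infinity (exp (\<omega> * t) * N1 * N2) I"
      using False by (simp add: quotient_or_infinity_def)
  qed (simp add: quotient_or_infinity_def)
qed

end
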